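(* Let $k = p_1p_2\cdots p_t \geq 6$ be even, where $p_1,\dots,p_t$ are primes, not necessarily distinct. Let $1 \leq i \leq t-1$ and suppose at least one of $p_1,\dots,p_i$ equals $2$. If $u \equiv 1 \pmod{p_1p_2\cdots p_i}$ and $g$ is odd with $g \equiv p_{i+1}p_{i+2}\cdots p_t \pmod{2p_{i+1}p_{i+2}\cdots p_t}$, then there exists a $k$-ARCS of $(K_u \times K_g)(2)$.
   Context: $u,g$ are positive integers. For graphs $G,H$, the tensor product $G \times H$ has vertex set $V(G)\times V(H)$, with $(g_1,h_1)$ adjacent to $(g_2,h_2)$ iff $g_1g_2 \in E(G)$ and $h_1h_2 \in E(H)$. For a graph $G$ and positive integer $\lambda$, $G(\lambda)$ is the multigraph obtained by replacing each edge of $G$ by $\lambda$ parallel edges. $K_n$ is the complete graph on $n$ vertices. $(K_u \times K_g)(\lambda)$ is regarded as a $u$-partite multigraph with partite sets $V_i = \{i\}\times V(K_g)$. A partial $C_k$-factor of $(K_u \times K_g)(\lambda)$ is a subgraph which, for some $i$, is a spanning subgraph of $(K_u \times K_g)(\lambda)\setminus V_i$ all of whose components are cycles of length $k$. A $k$-ARCS of $(K_u \times K_g)(\lambda)$ is a partition of its edge multiset into partial $C_k$-factors. *)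

theory Defs
  imports Complex_Main "HOL-Library.Multiset" "HOL-Computational_Algebra.Primes" "HOL-Number_Theory.Cong"
begin

text \<open>Edges are sets of end vertices; parallel edges of a multigraph are
  represented by the multiplicity of an edge in \<open>medges\<close>.\<close>

record 'a graph =
  verts :: "'a set"
  edges :: "'a set set"

record 'a multigraph =
  mverts :: "'a set"
  medges :: "'a set multiset"

definition complete_graph :: "nat \<Rightarrow> nat graph" where
  "complete_graph n = \<lparr>verts = {..<n}, edges = {e. e \<subseteq> {..<n} \<and> card e = 2}\<rparr>"

definition tensor_product :: "'a graph \<Rightarrow> 'b graph \<Rightarrow> ('a \<times> 'b) graph" where
  "tensor_product G H =
     \<lparr>verts = verts G \<times> verts H,
      edges = {{(g1, h1), (g2, h2)} | g1 h1 g2 h2. {g1, g2} \<in> edges G \<and> {h1, h2} \<in> edges H}\<rparr>"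

text \<open>The multigraph \<open>G(\<lambda>)\<close>; meaningful for finite \<open>G\<close>, since \<open>mset_set\<close> is empty on infinite sets.\<close>

definition multiply_edges :: "'a graph \<Rightarrow> nat \<Rightarrow> 'a multigraph" where
  "multiply_edges G l = \<lparr>mverts = verts G, medges = repeat_mset l (mset_set (edges G))\<rparr>"

definition delete_verts :: "'a multigraph \<Rightarrow> 'a set \<Rightarrow> 'a multigraph" where
  "delete_verts M W =
     \<lparr>mverts = mverts M - W, medges = filter_mset (\<lambda>e. e \<inter> W = {}) (medges M)\<rparr>"

definition spanning_subgraph :: "'a multigraph \<Rightarrow> 'a multigraph \<Rightarrow> bool" where
  "spanning_subgraph F M \<longleftrightarrow> mverts F = mverts M \<and> medges F \<subseteq># medges M"

definition adjacent :: "'a multigraph \<Rightarrow> 'a \<Rightarrow> 'a \<Rightarrow> bool" where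
  "adjacent M x y \<longleftrightarrow> {x, y} \<in># medges M"

definition components :: "'a multigraph \<Rightarrow> 'a multigraph set" where
  "components M =
     {\<lparr>mverts = C, medges = filter_mset (\<lambda>e. e \<subseteq> C) (medges M)\<rparr> | C.
        \<exists>v\<in>mverts M. C = {w \<in> mverts M. (adjacent M)\<^sup>*\<^sup>* v w}}"

definition is_cycle :: "nat \<Rightarrow> 'a multigraph \<Rightarrow> bool" where
  "is_cycle k M \<longleftrightarrow> k \<ge> 3 \<and>
     (\<exists>xs. length xs = k \<and> distinct xs \<and> mverts M = set xs \<and>
        medges M = image_mset (\<lambda>j. {xs ! j, xs ! (Suc j mod k)}) (mset_set {..<k}))"

definition partial_cycle_factor ::
    "nat \<Rightarrow> 'a multigraph \<Rightarrow> 'a set set \<Rightarrow> 'a multigraph \<Rightarrow> bool" where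
  "partial_cycle_factor k M parts F \<longleftrightarrow>
     (\<exists>W\<in>parts. spanning_subgraph F (delete_verts M W) \<and> (\<forall>C\<in>components F. is_cycle k C))"

text \<open>The partition is a multiset of factors, because with parallel edges the same
  factor may occur repeatedly.\<close>

definition is_ARCS ::
    "nat \<Rightarrow> 'a multigraph \<Rightarrow> 'a set set \<Rightarrow> 'a multigraph multiset \<Rightarrow> bool" where
  "is_ARCS k M parts \<F> \<longleftrightarrow>
     (\<forall>F\<in>#\<F>. partial_cycle_factor k M parts F) \<and> (\<Sum>F\<in>#\<F>. medges F) = medges M"

definition tensor_multigraph :: "nat \<Rightarrow> nat \<Rightarrow> nat \<Rightarrow> (nat \<times> nat) multigraph" where
  "tensor_multigraph u g l = multiply_edges (tensor_product (complete_graph u) (complete_graph g)) l"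

definition tensor_parts :: "nat \<Rightarrow> nat \<Rightarrow> (nat \<times> nat) set set" where
  "tensor_parts u g = {{j} \<times> verts (complete_graph g) | j. j \<in> verts (complete_graph u)}"

end

theory Submission
  imports Defs
begin

text \<open>Put \<open>a = p\<^sub>1\<dots>p\<^sub>i\<close> (even) and \<open>b = p\<^sub>i\<^sub>+\<^sub>1\<dots>p\<^sub>t\<close> (odd, at least 3), so \<open>u = 1 + a s\<close> and
  \<open>g = b m\<close>.

  Suppose that the complete digraph on \<open>u\<close> points splits into \<open>u\<close> directed near-factors with all
  cycles of length \<open>a\<close>, one missing each point. Lift an \<open>a\<close>-cycle to the product with \<open>\<int>\<^sub>g\<close> by
  shifting along its steps by \<open>j, -j, j, \<dots>, j, -\<tau>(j)\<close>, where \<open>\<tau>\<close> permutes the nonzero residues and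
  all \<open>j - \<tau>(j)\<close> have order \<open>b\<close>. All cycles of the lift have length \<open>a b\<close>, and as \<open>j\<close> varies over
  the nonzero residues every arc of the tensor product is used once, hence every edge twice.

  The near-factors exist for every even \<open>a = 2h\<close>. For \<open>s = 1\<close> and \<open>s = 2\<close> they are developed from
  zigzag cycles. If \<open>s\<close> is odd, twice an odd number or a multiple of 4, the points other than
  infinity are split into an odd number of groups or into 4 groups; perfect matchings outside a
  group, blown up so that each edge becomes a complete bipartite graph, supply the cycles between
  the groups, and the groups with infinity are filled with smaller solutions.\<close>

section \<open>Permutations all of whose cycles have the same length\<close>

text \<open>For \<open>a > 0\<close> the divisibility condition says that \<open>f\<close> splits
  \<open>S\<close> into disjoint directed cycles of length exactly \<open>a\<close>. Values of
  \<open>f\<close> outside \<open>S\<close> are left free.\<close>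

definition regular_cyc :: "nat \<Rightarrow> ('a \<Rightarrow> 'a) \<Rightarrow> 'a set \<Rightarrow> bool" where
  "regular_cyc a f S \<longleftrightarrow> (\<forall>x\<in>S. f x \<in> S \<and> (\<forall>j. (f ^^ j) x = x \<longleftrightarrow> a dvd j))"

lemma regular_cyc_closed: "regular_cyc a f S \<Longrightarrow> x \<in> S \<Longrightarrow> f x \<in> S"
  by (simp add: regular_cyc_def)

lemma regular_cyc_period: "regular_cyc a f S \<Longrightarrow> x \<in> S \<Longrightarrow> (f ^^ j) x = x \<longleftrightarrow> a dvd j"
  by (simp add: regular_cyc_def)

lemma regular_cyc_funpow_closed: "regular_cyc a f S \<Longrightarrow> x \<in> S \<Longrightarrow> (f ^^ j) x \<in> S"
  by (induction j) (auto simp: regular_cyc_closed)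

text \<open>Equal images under \<open>f\<close> give equal images under \<open>f ^^ a\<close>, which
  is the identity on \<open>S\<close>.\<close>

lemma regular_cyc_inj_on:
  assumes "regular_cyc a f S" "a > 0"
  shows "inj_on f S"
proof (rule inj_onI)
  fix x y assume xy: "x \<in> S" "y \<in> S" "f x = f y"
  obtain n where n: "a = Suc n" using assms(2) by (cases a) auto
  have "(f ^^ a) x = (f ^^ a) y"
    using xy(3) by (simp add: n funpow_Suc_right del: funpow.simps)
  then show "x = y"
    using regular_cyc_period[OF assms(1) xy(1), of a] regular_cyc_period[OF assms(1) xy(2), of a]
    by simp
qed

lemma regular_cyc_funpow_eq_iff:
  assumes "regular_cyc a f S" "a > 0" "x \<in> S"
  shows "(f ^^ i) x = (f ^^ j) x \<longleftrightarrow> i mod a = j mod a"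
proof -
  have *: "(f ^^ i) x = (f ^^ j) x \<longleftrightarrow> i mod a = j mod a" if "i \<le> j" for i j
  proof -
    have inj: "(f ^^ i) y = (f ^^ i) z \<longleftrightarrow> y = z" if "y \<in> S" "z \<in> S" for y z
    proof (induction i)
      case (Suc i)
      then show ?case
        using inj_on_eq_iff[OF regular_cyc_inj_on[OF assms(1,2)]
          regular_cyc_funpow_closed[OF assms(1) that(1)] regular_cyc_funpow_closed[OF assms(1) that(2)]]
        by simp
    qed simp
    have "(f ^^ j) x = (f ^^ i) ((f ^^ (j - i)) x)"
      using funpow_add[of i "j - i" f] that by simp
    then have "(f ^^ i) x = (f ^^ j) x \<longleftrightarrow> (f ^^ (j - i)) x = x"
      using inj[OF regular_cyc_funpow_closed[OF assms(1,3)] assms(3), of "j - i"] by (auto simp: eq_commute)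
    also have "\<dots> \<longleftrightarrow> a dvd j - i"
      using regular_cyc_period[OF assms(1,3)] .
    also have "\<dots> \<longleftrightarrow> i mod a = j mod a"
      using mod_eq_dvd_iff_nat[OF that, of a] by (auto simp: eq_commute)
    finally show ?thesis .
  qed
  show ?thesis
    using *[of i j] *[of j i] by (cases "i \<le> j") (auto simp: eq_commute)
qed

lemma regular_cyc_conj:
  assumes reg: "regular_cyc a f S" and g: "bij_betw g S S'"
    and comm: "\<And>x. x \<in> S \<Longrightarrow> f' (g x) = g (f x)"
  shows "regular_cyc a f' S'"
  unfolding regular_cyc_def
proof
  fix z assume "z \<in> S'"
  then obtain x where x: "x \<in> S" "z = g x"
    using g by (auto simp: bij_betw_def)
  have pow: "(f' ^^ j) z = g ((f ^^ j) x)" for j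
    by (induction j) (auto simp: x comm regular_cyc_funpow_closed[OF reg])
  have "(f' ^^ j) z = z \<longleftrightarrow> a dvd j" for j
    using inj_on_eq_iff[OF bij_betw_imp_inj_on[OF g] regular_cyc_funpow_closed[OF reg x(1)] x(1)]
      regular_cyc_period[OF reg x(1)] unfolding pow by (simp add: x(2))
  moreover have "f' z \<in> S'"
    using x comm regular_cyc_closed[OF reg] g by (auto simp: bij_betw_def)
  ultimately show "f' z \<in> S' \<and> (\<forall>j. (f' ^^ j) z = z \<longleftrightarrow> a dvd j)" by blast
qed

lemma regular_cyc_cong:
  assumes "regular_cyc a f S" "\<And>x. x \<in> S \<Longrightarrow> f' x = f x"
  shows "regular_cyc a f' S"
  using regular_cyc_conj[OF assms(1), of id S f'] assms(2) by auto

text \<open>The period is a property of single points, so near-factors may be assembled piece by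
  piece.\<close>

lemma regular_cyc_local:
  assumes "\<And>x. x \<in> S \<Longrightarrow> \<exists>S'. x \<in> S' \<and> S' \<subseteq> S \<and> regular_cyc a f S'"
  shows "regular_cyc a f S"
  unfolding regular_cyc_def
proof
  fix x assume "x \<in> S"
  then obtain S' where "x \<in> S'" "S' \<subseteq> S" "regular_cyc a f S'" using assms by blast
  then show "f x \<in> S \<and> (\<forall>j. (f ^^ j) x = x \<longleftrightarrow> a dvd j)"
    by (auto simp: regular_cyc_def)
qed

text \<open>Numbering the points along each cycle from a chosen representative lets the lift
  alternate the sign of its shifts.\<close>

lemma regular_cyc_position:
  assumes reg: "regular_cyc a f S" and a: "a > 0"
  obtains pos where "\<And>x. x \<in> S \<Longrightarrow> pos x < a \<and> pos (f x) = Suc (pos x) mod a"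
proof -
  define orb where "orb x = {y. \<exists>j. y = (f ^^ j) x}" for x
  \<comment> \<open>The choice depends only on the set \<open>orb x\<close>, so all points of one
    cycle get the same representative.\<close>
  define rep where "rep x = (SOME y. y \<in> orb x)" for x
  define pos where "pos x = (SOME j. j < a \<and> (f ^^ j) (rep x) = x)" for x
  have orb_f: "orb (f x) = orb x" if "x \<in> S" for x
  proof -
    obtain n where n: "a = Suc n" using a by (cases a) auto
    have fa: "(f ^^ a) x = x" using regular_cyc_period[OF reg that] by simp
    have "\<exists>i. (f ^^ j) x = (f ^^ i) (f x)" for j
    proof -
      have "(f ^^ (j + n)) (f x) = (f ^^ j) ((f ^^ a) x)"
        by (simp add: n funpow_add funpow_Suc_right del: funpow.simps)
      then show ?thesis using fa by metis
    qed
    moreover have "(f ^^ j) (f x) = (f ^^ Suc j) x" for j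
      by (simp add: funpow_Suc_right del: funpow.simps)
    ultimately show ?thesis unfolding orb_def by blast
  qed
  have rep_S: "rep x \<in> S" and rep_j: "\<exists>j<a. (f ^^ j) (rep x) = x" if "x \<in> S" for x
  proof -
    have "x = (f ^^ 0) x" by simp
    then have "x \<in> orb x" unfolding orb_def by blast
    then have "rep x \<in> orb x" unfolding rep_def by (rule someI)
    then obtain j where j: "rep x = (f ^^ j) x" unfolding orb_def by blast
    then show S: "rep x \<in> S" using regular_cyc_funpow_closed[OF reg that] by simp
    \<comment> \<open>The representative lies \<open>j\<close> steps after \<open>x\<close>;
      \<open>a * j - j\<close> further steps complete a multiple of \<open>a\<close> and return to
      \<open>x\<close>.\<close>
    have "(f ^^ (a * j - j)) (rep x) = (f ^^ (a * j)) x"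
      using funpow_add[of "a * j - j" j f] a by (simp add: j)
    also have "\<dots> = x" using regular_cyc_period[OF reg that, of "a * j"] by simp
    finally have "(f ^^ ((a * j - j) mod a)) (rep x) = x"
      using regular_cyc_funpow_eq_iff[OF reg a S] by (metis mod_mod_trivial)
    then show "\<exists>j<a. (f ^^ j) (rep x) = x" using a by (meson mod_less_divisor)
  qed
  have pos: "pos x < a \<and> (f ^^ pos x) (rep x) = x" if "x \<in> S" for x
    unfolding pos_def by (rule someI_ex) (use rep_j[OF that] in blast)
  have "pos (f x) = Suc (pos x) mod a" if x: "x \<in> S" for x
  proof -
    have fx: "f x \<in> S" using regular_cyc_closed[OF reg x] .
    have "rep (f x) = rep x" unfolding rep_def orb_f[OF x] ..
    then have "(f ^^ pos (f x)) (rep x) = (f ^^ Suc (pos x)) (rep x)"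
      using pos[OF fx] pos[OF x] by simp
    then show ?thesis
      using regular_cyc_funpow_eq_iff[OF reg a rep_S[OF x]] pos[OF fx] by (metis mod_less)
  qed
  then show thesis using that pos by blast
qed

section \<open>From permutations to almost resolvable cycle systems\<close>

definition perm_graph :: "('a \<Rightarrow> 'a) \<Rightarrow> 'a set \<Rightarrow> 'a multigraph" where
  "perm_graph f W = \<lparr>mverts = W, medges = image_mset (\<lambda>z. {z, f z}) (mset_set W)\<rparr>"

text \<open>The component of \<open>v\<close> is its orbit: walking an edge backwards leads to the
  predecessor, which is also reached by \<open>k - 1\<close> forward steps.\<close>

lemma components_perm_graph:
  assumes reg: "regular_cyc k f W" and k: "k \<ge> 3" and fin: "finite W"
    and C: "C \<in> components (perm_graph f W)"
  shows "is_cycle k C"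
proof -
  have k0: "k > 0" using k by simp
  let ?adj = "adjacent (perm_graph f W)"
  obtain v where v: "v \<in> W"
    and Cv: "C = \<lparr>mverts = {w \<in> W. ?adj\<^sup>*\<^sup>* v w},
       medges = filter_mset (\<lambda>e. e \<subseteq> {w \<in> W. ?adj\<^sup>*\<^sup>* v w}) (medges (perm_graph f W))\<rparr>"
    using C unfolding components_def by (auto simp: perm_graph_def)
  have adj: "?adj x y \<longleftrightarrow> (x \<in> W \<and> y = f x) \<or> (y \<in> W \<and> x = f y)" for x y
    using fin by (auto simp: adjacent_def perm_graph_def doubleton_eq_iff)
  define Orb where "Orb = (\<lambda>j. (f ^^ j) v) ` {..<k}"
  have Orb: "(f ^^ j) v \<in> Orb" for j
  proof -
    have "(f ^^ j) v = (f ^^ (j mod k)) v"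
      using regular_cyc_funpow_eq_iff[OF reg k0 v] by simp
    then show ?thesis using k0 unfolding Orb_def by (metis imageI lessThan_iff mod_less_divisor)
  qed
  have OrbW: "Orb \<subseteq> W"
    unfolding Orb_def using regular_cyc_funpow_closed[OF reg v] by auto
  have "w \<in> Orb" if "?adj\<^sup>*\<^sup>* v w" for w
    using that
  proof induction
    case base
    show ?case using Orb[of 0] by simp
  next
    case (step y z)
    then obtain j where j: "y = (f ^^ j) v" unfolding Orb_def by auto
    from step(2)[unfolded adj] show ?case
    proof
      assume "y \<in> W \<and> z = f y"
      then show ?thesis using Orb[of "Suc j"] j by simp
    next
      assume z: "z \<in> W \<and> y = f z"
      have "f ((f ^^ (j + k - 1)) v) = (f ^^ (j + k)) v"
        using k0 by (metis Suc_pred' add_gr_0 comp_apply funpow.simps(2))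
      also have "\<dots> = f z"
        using z j regular_cyc_funpow_eq_iff[OF reg k0 v, of "j + k" j] by simp
      finally have "(f ^^ (j + k - 1)) v = z"
        using z regular_cyc_inj_on[OF reg k0] regular_cyc_funpow_closed[OF reg v]
        by (metis inj_onD)
      then show ?thesis using Orb by blast
    qed
  qed
  moreover have "?adj\<^sup>*\<^sup>* v ((f ^^ j) v)" for j
  proof (induction j)
    case (Suc j)
    have "?adj ((f ^^ j) v) ((f ^^ Suc j) v)"
      using adj regular_cyc_funpow_closed[OF reg v] by simp
    then show ?case using Suc by (meson rtranclp.rtrancl_into_rtrancl)
  qed simp
  ultimately have CO: "{w \<in> W. ?adj\<^sup>*\<^sup>* v w} = Orb"
    using OrbW unfolding Orb_def by auto
  have inj: "inj_on (\<lambda>j. (f ^^ j) v) {..<k}"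
    using regular_cyc_funpow_eq_iff[OF reg k0 v] by (auto intro!: inj_onI)
  define xs where "xs = map (\<lambda>j. (f ^^ j) v) [0..<k]"
  have f_Orb: "f z \<in> Orb" if z: "z \<in> Orb" for z
  proof -
    obtain j where "z = (f ^^ j) v" using z unfolding Orb_def by auto
    then show ?thesis using Orb[of "Suc j"] by simp
  qed
  have nth: "xs ! (Suc j mod k) = f ((f ^^ j) v)" if "j < k" for j
  proof -
    have "xs ! (Suc j mod k) = (f ^^ (Suc j mod k)) v" unfolding xs_def using k0 by simp
    also have "\<dots> = (f ^^ Suc j) v"
      using regular_cyc_funpow_eq_iff[OF reg k0 v] mod_mod_trivial by blast
    finally show ?thesis by simp
  qed
  have "medges C = filter_mset (\<lambda>e. e \<subseteq> Orb) (image_mset (\<lambda>z. {z, f z}) (mset_set W))"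
    unfolding Cv CO by (simp add: perm_graph_def)
  also have "\<dots> = image_mset (\<lambda>z. {z, f z}) (mset_set {z \<in> W. {z, f z} \<subseteq> Orb})"
    using fin by (simp add: filter_mset_image_mset filter_mset_mset_set)
  also have "{z \<in> W. {z, f z} \<subseteq> Orb} = Orb" using OrbW f_Orb by auto
  also have "mset_set Orb = image_mset (\<lambda>j. (f ^^ j) v) (mset_set {..<k})"
    unfolding Orb_def using inj by (simp add: image_mset_mset_set)
  also have "image_mset (\<lambda>z. {z, f z}) \<dots> = image_mset (\<lambda>j. {xs ! j, xs ! (Suc j mod k)}) (mset_set {..<k})"
    unfolding multiset.map_comp comp_def
    by (rule image_mset_cong) (auto simp: nth, auto simp: xs_def)
  finally have med: "medges C = image_mset (\<lambda>j. {xs ! j, xs ! (Suc j mod k)}) (mset_set {..<k})" .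
  have xs: "length xs = k" "distinct xs" "mverts C = set xs"
    using inj unfolding Cv CO by (simp_all add: xs_def Orb_def distinct_map atLeast0LessThan)
  show ?thesis unfolding is_cycle_def by (intro conjI exI[of _ xs] k med xs)
qed

lemma tensor_edges_eq:
  "edges (tensor_product (complete_graph u) (complete_graph g)) =
     {{p, q} | p q. p \<in> {..<u} \<times> {..<g} \<and> q \<in> {..<u} \<times> {..<g} \<and> fst p \<noteq> fst q \<and> snd p \<noteq> snd q}"
proof -
  have 2: "{x, y} \<in> edges (complete_graph n) \<longleftrightarrow> x < n \<and> y < n \<and> x \<noteq> y" for x y n :: nat
    by (auto simp: complete_graph_def card_insert_if)
  show ?thesis
    unfolding tensor_product_def graph.simps 2 by fastforce
qed

text \<open>An edge arises from the arc from \<open>p\<close> to \<open>q\<close> or from the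
  opposite arc, so its multiplicity counts both directions.\<close>

lemma card_doubleton_preimage:
  assumes "p \<noteq> q"
  shows "card {z \<in> W. {z, f z} = {p, q}} = of_bool (p \<in> W \<and> f p = q) + of_bool (q \<in> W \<and> f q = p)"
proof -
  have "{z \<in> W. {z, f z} = {p, q}} =
      (if p \<in> W \<and> f p = q then {p} else {}) \<union> (if q \<in> W \<and> f q = p then {q} else {})"
    using assms by (auto simp: doubleton_eq_iff)
  then show ?thesis using assms by auto
qed

lemma sum_of_bool_unique:
  assumes "finite I" "\<exists>!i. i \<in> I \<and> P i"
  shows "(\<Sum>i\<in>I. of_bool (P i)) = (1 :: nat)"
proof -
  obtain i where i: "i \<in> I" "P i" "\<And>j. j \<in> I \<Longrightarrow> P j \<Longrightarrow> j = i" using assms(2) by blast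
  have "of_bool (P j) = (if j = i then 1 else 0 :: nat)" if "j \<in> I" for j
    using i(2) i(3)[OF that] by (cases "P j") auto
  then have "(\<Sum>j\<in>I. of_bool (P j)) = (\<Sum>j\<in>I. if j = i then 1 else 0 :: nat)"
    by (rule sum.cong[OF refl])
  then show ?thesis using i(1) assms(1) by simp
qed

text \<open>Every edge carries two opposite arcs. Each arc is used exactly once, so the edge is used
  twice, which is its multiplicity for \<lambda> = 2. The value \<open>part i\<close> is the index
  of the partite set missed by factor \<open>i\<close>.\<close>

lemma ARCS_of_permutations:
  fixes u g k :: nat and part :: "'i \<Rightarrow> nat" and \<phi> :: "'i \<Rightarrow> nat \<times> nat \<Rightarrow> nat \<times> nat"
  defines "W i \<equiv> {p \<in> {..<u} \<times> {..<g}. fst p \<noteq> part i}"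
  assumes k: "k \<ge> 3" and fin: "finite I"
    and part: "\<And>i. i \<in> I \<Longrightarrow> part i < u"
    and reg: "\<And>i. i \<in> I \<Longrightarrow> regular_cyc k (\<phi> i) (W i)"
    and arcs: "\<And>i p. i \<in> I \<Longrightarrow> p \<in> W i \<Longrightarrow> fst (\<phi> i p) \<noteq> fst p \<and> snd (\<phi> i p) \<noteq> snd p"
    and cover: "\<And>p q. p \<in> {..<u} \<times> {..<g} \<Longrightarrow> q \<in> {..<u} \<times> {..<g} \<Longrightarrow> fst p \<noteq> fst q \<Longrightarrow>
      snd p \<noteq> snd q \<Longrightarrow> \<exists>!i. i \<in> I \<and> p \<in> W i \<and> \<phi> i p = q"
  shows "\<exists>\<F>. is_ARCS k (tensor_multigraph u g 2) (tensor_parts u g) \<F>"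
proof -
  define E where "E = {{p, q} | p q. p \<in> {..<u} \<times> {..<g} \<and> q \<in> {..<u} \<times> {..<g} \<and>
    fst p \<noteq> fst q \<and> snd p \<noteq> snd (q :: nat \<times> nat)}"
  let ?M = "tensor_multigraph u g 2"
  have finE: "finite E"
    by (rule finite_subset[of _ "Pow ({..<u} \<times> {..<g})"]) (auto simp: E_def)
  have finW: "finite (W i)" for i unfolding W_def by simp
  have medM: "medges ?M = repeat_mset 2 (mset_set E)"
    unfolding tensor_multigraph_def multiply_edges_def tensor_edges_eq E_def by simp
  have vertM: "mverts ?M = {..<u} \<times> {..<g}"
    by (simp add: tensor_multigraph_def multiply_edges_def tensor_product_def complete_graph_def)
  have countF: "count (medges (perm_graph (\<phi> i) (W i))) e = card {z \<in> W i. {z, \<phi> i z} = e}" for i e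
  proof -
    have "count (medges (perm_graph (\<phi> i) (W i))) e =
        size (filter_mset (\<lambda>z. {z, \<phi> i z} = e) (mset_set (W i)))"
      unfolding perm_graph_def by (simp add: count_conv_size_mset filter_mset_image_mset eq_commute)
    then show ?thesis using finW by (simp add: filter_mset_mset_set)
  qed
  have total: "(\<Sum>i\<in>I. count (medges (perm_graph (\<phi> i) (W i))) e) = count (medges ?M) e" for e
  proof (cases "e \<in> E")
    case True
    then obtain p q where e: "e = {p, q}" and pq: "p \<in> {..<u} \<times> {..<g}" "q \<in> {..<u} \<times> {..<g}"
      "fst p \<noteq> fst q" "snd p \<noteq> snd q" unfolding E_def by blast
    have "p \<noteq> q" using pq by auto
    then have "(\<Sum>i\<in>I. card {z \<in> W i. {z, \<phi> i z} = e}) =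
        (\<Sum>i\<in>I. of_bool (p \<in> W i \<and> \<phi> i p = q)) + (\<Sum>i\<in>I. of_bool (q \<in> W i \<and> \<phi> i q = p))"
      unfolding e by (simp add: card_doubleton_preimage sum.distrib)
    also have "\<dots> = 2"
      using sum_of_bool_unique[OF fin cover[OF pq]]
        sum_of_bool_unique[OF fin cover[OF pq(2,1) pq(3,4)[symmetric]]] by simp
    finally show ?thesis using True finE by (simp add: countF medM)
  next
    case False
    have empty: "{z \<in> W i. {z, \<phi> i z} = e} = {}" if i: "i \<in> I" for i
    proof -
      have "{z, \<phi> i z} \<in> E" if "z \<in> W i" for z
      proof -
        have "z \<in> {..<u} \<times> {..<g}" "\<phi> i z \<in> {..<u} \<times> {..<g}"
          using that regular_cyc_closed[OF reg[OF i]] by (auto simp: W_def)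
        then show ?thesis using arcs[OF i that] unfolding E_def by (metis (mono_tags, lifting) CollectI)
      qed
      then show ?thesis using False by blast
    qed
    have "card {z \<in> W i. {z, \<phi> i z} = e} = 0" if "i \<in> I" for i
      unfolding empty[OF that] by simp
    then show ?thesis using False finE by (simp add: countF medM)
  qed
  let ?F = "\<lambda>i. perm_graph (\<phi> i) (W i)"
  have pcf: "partial_cycle_factor k ?M (tensor_parts u g) (?F i)" if i: "i \<in> I" for i
  proof -
    let ?P = "{part i} \<times> {..<g}"
    have "?P \<in> tensor_parts u g"
      using part[OF i] by (auto simp: tensor_parts_def complete_graph_def)
    moreover have "spanning_subgraph (?F i) (delete_verts ?M ?P)"
    proof -
      have "mverts (?F i) = mverts (delete_verts ?M ?P)"
        unfolding delete_verts_def vertM by (auto simp: perm_graph_def W_def)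
      moreover have "medges (?F i) \<subseteq># medges (delete_verts ?M ?P)"
      proof (rule mset_subset_eqI)
        fix e
        show "count (medges (?F i)) e \<le> count (medges (delete_verts ?M ?P)) e"
        proof (cases "e \<inter> ?P = {}")
          case True
          \<comment> \<open>One factor uses \<open>e\<close> at most as often as all factors
            together, and that total is already known.\<close>
          have "count (medges (?F i)) e \<le> (\<Sum>i\<in>I. count (medges (?F i)) e)"
            using i fin by (intro member_le_sum) auto
          then show ?thesis using True total by (simp add: delete_verts_def)
        next
          case False
          have disj: "{z, \<phi> i z} \<inter> ?P = {}" if "z \<in> W i" for z
            using that regular_cyc_closed[OF reg[OF i] that] by (auto simp: W_def)
          have empty: "{z \<in> W i. {z, \<phi> i z} = e} = {}"
          proof (rule equals0I)
            fix z assume "z \<in> {z \<in> W i. {z, \<phi> i z} = e}"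
            then have "z \<in> W i" "{z, \<phi> i z} = e" by (simp_all only: mem_Collect_eq)
            then show False using disj[of z] False by simp
          qed
          show ?thesis unfolding countF empty by simp
        qed
      qed
      ultimately show ?thesis unfolding spanning_subgraph_def by simp
    qed
    moreover have "\<forall>C\<in>components (?F i). is_cycle k C"
      by (intro ballI components_perm_graph[OF reg[OF i] k finW])
    ultimately show ?thesis
      unfolding partial_cycle_factor_def by blast
  qed
  have sum: "(\<Sum>F\<in>#image_mset ?F (mset_set I). medges F) = medges ?M"
  proof (rule multiset_eqI)
    fix e
    have "count (\<Sum>F\<in>#image_mset ?F (mset_set I). medges F) e = (\<Sum>i\<in>I. count (medges (?F i)) e)"
      by (simp add: multiset.map_comp comp_def sum_unfold_sum_mset[symmetric] count_sum)
    then show "count (\<Sum>F\<in>#image_mset ?F (mset_set I). medges F) e = count (medges ?M) e"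
      using total by simp
  qed
  show ?thesis
    unfolding is_ARCS_def using pcf fin sum
    by (intro exI[of _ "image_mset ?F (mset_set I)"] conjI) auto
qed

section \<open>Directed near-factorizations\<close>

text \<open>\<open>op v\<close> is the successor map of the near-factor missing \<open>v\<close>; its value at \<open>v\<close> is irrelevant. By
  finiteness the injectivity condition means that every arc is used exactly once.\<close>

definition near_cyclic :: "nat \<Rightarrow> 'a set \<Rightarrow> ('a \<Rightarrow> 'a \<Rightarrow> 'a) \<Rightarrow> bool" where
  "near_cyclic a V op \<longleftrightarrow> finite V \<and> (\<forall>v\<in>V. regular_cyc a (op v) (V - {v})) \<and>
     (\<forall>x\<in>V. inj_on (\<lambda>v. op v x) (V - {x}))"

lemma near_cyclic_closed:
  assumes "near_cyclic a V op" "a \<ge> 2" "v \<in> V" "x \<in> V" "v \<noteq> x"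
  shows "op v x \<in> V - {v, x}"
proof -
  have reg: "regular_cyc a (op v) (V - {v})" using assms by (auto simp: near_cyclic_def)
  have x: "x \<in> V - {v}" using assms by simp
  have "op v x \<noteq> x" using regular_cyc_period[OF reg x, of 1] assms(2) by simp
  then show ?thesis using regular_cyc_closed[OF reg x] by simp
qed

text \<open>For fixed \<open>x\<close>, the map sending \<open>v\<close> to \<open>op v x\<close> is
  an injective self-map of the finite set \<open>V - {x}\<close>, hence a bijection.\<close>

lemma near_cyclic_arc_unique:
  assumes nc: "near_cyclic a V op" "a \<ge> 2" and x: "x \<in> V" and y: "y \<in> V" "x \<noteq> y"
  shows "\<exists>!v. v \<in> V - {x} \<and> op v x = y"
proof -
  have inj: "inj_on (\<lambda>v. op v x) (V - {x})" and fin: "finite (V - {x})"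
    using nc x by (auto simp: near_cyclic_def)
  have "(\<lambda>v. op v x) ` (V - {x}) \<subseteq> V - {x}"
  proof (rule image_subsetI)
    fix v assume "v \<in> V - {x}"
    then show "op v x \<in> V - {x}" using near_cyclic_closed[OF nc, of v x] x by simp
  qed
  then have "(\<lambda>v. op v x) ` (V - {x}) = V - {x}"
    using inj by (rule endo_inj_surj[OF fin])
  moreover have "y \<in> V - {x}" using y by simp
  ultimately have "y \<in> (\<lambda>v. op v x) ` (V - {x})" by simp
  then obtain v where v: "y = op v x" "v \<in> V - {x}" by (rule imageE)
  show ?thesis
  proof (rule ex1I[of _ v])
    show "w = v" if "w \<in> V - {x} \<and> op w x = y" for w
      by (rule inj_onD[OF inj]) (use that v in simp_all)
  qed (use v in simp)
qed

section \<open>Lifting along the complete graph on an odd number of points\<close>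

text \<open>Translation by \<open>m\<close> has every difference of order \<open>b\<close> modulo
  \<open>b * m\<close>, but it moves 0. Bypassing 0 changes one difference from \<open>- m\<close>
  to \<open>- 2 * m\<close> modulo \<open>b * m\<close>, which still has order \<open>b\<close>
  because \<open>b\<close> is odd.\<close>

lemma ex_near_translation:
  fixes b m :: int
  assumes b: "odd b" "b \<ge> 3" and m: "m > 0"
  shows "\<exists>\<tau>. \<tau> ` {1..<b * m} \<subseteq> {1..<b * m} \<and> inj_on \<tau> {1..<b * m} \<and>
    (\<forall>j t. b * m dvd (j - \<tau> j) * t \<longleftrightarrow> b dvd t)"
proof -
  define g where "g = b * m"
  have gm: "3 * m \<le> g" unfolding g_def using assms by (intro mult_right_mono) auto
  \<comment> \<open>The residue \<open>g - m\<close>, which translation would send to 0, goes on to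
    \<open>m\<close>, the image of 0.\<close>
  define \<tau> where "\<tau> j = (if j + m < g then j + m else if j + m = g then m else j + m - g)" for j
  have mem: "\<tau> j \<in> {1..<g}" if "j \<in> {1..<g}" for j
    using that m gm unfolding \<tau>_def by auto
  have inj: "i = j" if "i \<in> {1..<g}" "j \<in> {1..<g}" "\<tau> i = \<tau> j" for i j
    using that m gm unfolding \<tau>_def by (simp split: if_splits)
  have order: "g dvd (j - \<tau> j) * t \<longleftrightarrow> b dvd t" for j t
  proof -
    have *: "g dvd (c * m) * t \<longleftrightarrow> b dvd t" if "coprime b c" for c
    proof -
      have "(c * m) * t = (c * t) * m" by simp
      then have "g dvd (c * m) * t \<longleftrightarrow> b * m dvd (c * t) * m" unfolding g_def by simp
      also have "\<dots> \<longleftrightarrow> b dvd c * t" using m by simp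
      also have "\<dots> \<longleftrightarrow> b dvd t" using that by (simp add: coprime_dvd_mult_right_iff)
      finally show ?thesis .
    qed
    \<comment> \<open>The differences are \<open>-1\<close>, \<open>b - 2\<close> and
      \<open>b - 1\<close> times \<open>m\<close>; these factors are prime to \<open>b\<close>, the
      second one by oddness.\<close>
    have "coprime b 2" using b by simp
    moreover have "coprime b (b - c)" if c: "coprime b c" for c
    proof (rule coprimeI)
      fix x assume x: "x dvd b" "x dvd b - c"
      then have "x dvd c" using dvd_diff[of x b "b - c"] by simp
      then show "is_unit x" using c x(1) coprime_common_divisor by blast
    qed
    ultimately have co: "coprime b (b - 2)" "coprime b (b - 1)" "coprime b (-1)" by simp_all
    consider "j - \<tau> j = (-1) * m" | "j - \<tau> j = (b - 2) * m" | "j - \<tau> j = (b - 1) * m"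
    proof -
      have "j - \<tau> j = - m \<or> j - \<tau> j = g - 2 * m \<or> j - \<tau> j = g - m"
        unfolding \<tau>_def by auto
      then show ?thesis using that unfolding g_def by (auto simp: left_diff_distrib)
    qed
    then show ?thesis
    proof cases
      case 1 then show ?thesis using *[OF co(3)] by simp
    next
      case 2 then show ?thesis using *[OF co(1)] by simp
    next
      case 3 then show ?thesis using *[OF co(2)] by simp
    qed
  qed
  have "\<tau> ` {1..<g} \<subseteq> {1..<g}" using mem by blast
  moreover have "inj_on \<tau> {1..<g}" by (rule inj_onI) (rule inj)
  ultimately show ?thesis using order unfolding g_def by blast
qed

text \<open>The shift cancels along a cycle except for the total \<open>c - c'\<close>, collected in the last step.\<close>

lemma regular_cyc_lift:
  fixes G c c' :: int
  assumes reg: "regular_cyc a f S" and a: "even a" "a > 0" and G: "G > 0"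
    and pos: "\<And>x. x \<in> S \<Longrightarrow> pos x < a \<and> pos (f x) = Suc (pos x) mod a"
    and order: "\<And>t. G dvd (c - c') * t \<longleftrightarrow> int b dvd t"
    and d: "\<And>x. d x = (if even (pos x) then c else if Suc (pos x) = a then - c' else - c)"
  shows "regular_cyc (a * b) (\<lambda>(x, y). (f x, (y + d x) mod G)) (S \<times> {0..<G})"
    (is "regular_cyc _ ?\<psi> _")
  unfolding regular_cyc_def
proof (intro ballI)
  fix z assume "z \<in> S \<times> {0..<G}"
  then obtain x y where z: "z = (x, y)" and x: "x \<in> S" and y: "y \<in> {0..<G}" by (rule SigmaE)
  \<comment> \<open>\<open>P\<close> is the shift still pending at a point: an even position adds
    \<open>c\<close> and the following odd position takes it away.\<close>
  define P where "P x = (if odd (pos x) then c else 0)" for x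
  define T where "T = c - c'"
  have clo: "(f ^^ l) x \<in> S" for l
    using regular_cyc_funpow_closed[OF reg x] .
  have pos_l: "pos ((f ^^ l) x) = (pos x + l) mod a" for l
  proof (induction l)
    case 0
    then show ?case using pos[OF x] by simp
  next
    case (Suc l)
    then show ?case using pos[OF clo[of l]] by (simp add: mod_Suc_eq)
  qed
  \<comment> \<open>The quotient counts the passages through the last position of the cycle; each of
    them leaves the net shift \<open>T\<close>.\<close>
  have iter: "(?\<psi> ^^ l) z = ((f ^^ l) x, (y - P x + T * int ((pos x + l) div a) + P ((f ^^ l) x)) mod G)" for l
  proof (induction l)
    case 0
    show ?case using pos[OF x] y by (simp add: z)
  next
    case (Suc l)
    let ?x = "(f ^^ l) x" and ?q = "(pos x + l) div a"
    have q: "(pos x + Suc l) div a = (if Suc (pos ?x) = a then Suc ?q else ?q)"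
      unfolding pos_l by (simp add: div_Suc mod_Suc)
    have r: "pos (f ?x) = (if Suc (pos ?x) = a then 0 else Suc (pos ?x))"
      using pos[OF clo[of l]] by (simp add: mod_Suc)
    have "P ?x + T * int ?q + d ?x = T * int ((pos x + Suc l) div a) + P (f ?x)"
    proof (cases "Suc (pos ?x) = a")
      case True
      \<comment> \<open>Since \<open>a\<close> is even, the last position is odd, so a shift
        \<open>c\<close> is pending there and subtracting \<open>c'\<close> leaves
        \<open>T\<close>.\<close>
      then have "odd (pos ?x)" using a(1) by auto
      then show ?thesis unfolding q P_def r d T_def using True by (simp add: algebra_simps)
    next
      case False
      then show ?thesis unfolding q P_def r d T_def by simp
    qed
    then have eq: "(y - P x + T * int ?q + P ?x) + d ?x =
        y - P x + T * int ((pos x + Suc l) div a) + P (f ?x)" by simp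
    show ?case
      by (simp only: funpow.simps comp_apply Suc.IH prod.case mod_add_left_eq eq)
  qed
  have "(?\<psi> ^^ l) z = z \<longleftrightarrow> a * b dvd l" for l
  proof (cases "a dvd l")
    case True
    then obtain t where t: "l = a * t" by blast
    have fx: "(f ^^ l) x = x" using True regular_cyc_period[OF reg x] by blast
    have "(pos x + l) div a = t" using pos[OF x] a(2) by (simp add: t)
    then have "(?\<psi> ^^ l) z = z \<longleftrightarrow> (y + T * int t) mod G = y mod G"
      unfolding iter fx using y by (simp add: z)
    also have "\<dots> \<longleftrightarrow> G dvd T * int t" by (simp add: mod_eq_dvd_iff)
    also have "\<dots> \<longleftrightarrow> int b dvd int t" unfolding T_def by (rule order)
    also have "\<dots> \<longleftrightarrow> a * b dvd l" using a(2) by (simp add: t)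
    finally show ?thesis .
  next
    case False
    then have "(f ^^ l) x \<noteq> x" using regular_cyc_period[OF reg x] by blast
    moreover have "\<not> a * b dvd l" using False dvd_mult_left by blast
    ultimately show ?thesis unfolding iter by (simp add: z)
  qed
  moreover have "?\<psi> z \<in> S \<times> {0..<G}"
    using regular_cyc_closed[OF reg x] G by (simp add: z)
  ultimately show "?\<psi> z \<in> S \<times> {0..<G} \<and> (\<forall>l. (?\<psi> ^^ l) z = z \<longleftrightarrow> a * b dvd l)"
    by blast
qed

text \<open>Factors are indexed by the missed part \<open>v\<close> and a nonzero residue
  \<open>j\<close>. The first coordinates of an arc determine \<open>v\<close>, and then the
  difference of the second coordinates determines \<open>j\<close>.\<close>

lemma ARCS_of_near_cyclic:
  fixes a b m u g :: nat
  assumes nc: "near_cyclic a {..<u} op" and a: "even a" "a > 0"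
    and g: "g = b * m" and b: "odd b" "b \<ge> 3" and m: "m > 0"
  shows "\<exists>\<F>. is_ARCS (a * b) (tensor_multigraph u g 2) (tensor_parts u g) \<F>"
proof -
  let ?g = "int g" and ?m = "int m" and ?b = "int b"
  have a2: "a \<ge> 2" using a by (auto elim!: evenE)
  have g': "?g = ?b * ?m" using g by simp
  have g0: "?g > 0" using g b m by simp
  define J where "J = {1..<?g}"
  obtain \<tau> where "\<tau> ` J \<subseteq> J" and tau_inj: "inj_on \<tau> J"
    and order: "\<And>j t. ?g dvd (j - \<tau> j) * t \<longleftrightarrow> ?b dvd t"
    using ex_near_translation[of ?b ?m] b m unfolding J_def g' by auto
  then have tau_J: "\<tau> j \<in> J" if "j \<in> J" for j
    using that by blast
  have reg: "regular_cyc a (op v) ({..<u} - {v})" if "v < u" for v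
    using nc that by (auto simp: near_cyclic_def)
  have "\<exists>pos. \<forall>x\<in>{..<u} - {v}. pos x < a \<and> pos (op v x) = Suc (pos x) mod a" if v: "v < u" for v
    by (rule regular_cyc_position[OF reg[OF v] a(2)]) blast
  then have "\<forall>v\<in>{..<u}. \<exists>pos. \<forall>x\<in>{..<u} - {v}. pos x < a \<and> pos (op v x) = Suc (pos x) mod a"
    by simp
  from bchoice[OF this] obtain pos where "\<forall>v\<in>{..<u}. \<forall>x\<in>{..<u} - {v}.
      pos v x < a \<and> pos v (op v x) = Suc (pos v x) mod a"
    by blast
  then have pos: "pos v x < a \<and> pos v (op v x) = Suc (pos v x) mod a"
    if "v < u" "x \<in> {..<u} - {v}" for v x
    using that by simp
  define d where "d v j x = (if even (pos v x) then j else if Suc (pos v x) = a then - \<tau> j else - j)" for v j x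
  have reg_lift: "regular_cyc (a * b) (\<lambda>(x, y). (op v x, (y + d v j x) mod ?g)) (({..<u} - {v}) \<times> {0..<?g})"
    if v: "v < u" for v j
    by (rule regular_cyc_lift[where pos = "pos v" and c = j and c' = "\<tau> j" and d = "d v j",
          OF reg[OF v] a g0 pos[OF v] order d_def])
  \<comment> \<open>This is the shift applied at \<open>x\<close> as a residue. In \<open>j\<close>
    it is the identity, negation or negated \<tau>, hence a permutation of the nonzero
    residues.\<close>
  define D where "D v x j = d v j x mod ?g" for v x j
  have mod_eq: "i = j" if "i mod ?g = j mod ?g" "i \<in> J" "j \<in> J" for i j
    using that unfolding J_def by simp
  have mod_neg_eq: "i = j" if "(- i) mod ?g = (- j) mod ?g" "i \<in> J" "j \<in> J" for i j
  proof -
    have "i mod ?g = j mod ?g" using mod_minus_cong[OF that(1)] by simp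
    then show ?thesis by (rule mod_eq[OF _ that(2,3)])
  qed
  have mod_J: "i mod ?g \<in> J" "(- i) mod ?g \<in> J" if "i \<in> J" for i
    using that by (auto simp: J_def zmod_zminus1_eq_if)
  have D_J: "D v x ` J \<subseteq> J" for v x
    unfolding D_def d_def using mod_J tau_J by auto
  have D_inj: "inj_on (D v x) J" for v x
  proof (rule inj_onI)
    fix i j assume ij: "i \<in> J" "j \<in> J" "D v x i = D v x j"
    consider "i mod ?g = j mod ?g" | "(- i) mod ?g = (- j) mod ?g" | "(- \<tau> i) mod ?g = (- \<tau> j) mod ?g"
      using ij(3) unfolding D_def d_def by (auto split: if_splits)
    then show "i = j"
    proof cases
      case 1 then show ?thesis by (rule mod_eq[OF _ ij(1,2)])
    next
      case 2 then show ?thesis by (rule mod_neg_eq[OF _ ij(1,2)])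
    next
      case 3
      then have "\<tau> i = \<tau> j" by (rule mod_neg_eq[OF _ tau_J[OF ij(1)] tau_J[OF ij(2)]])
      then show ?thesis using ij(1,2) by (rule inj_onD[OF tau_inj])
    qed
  qed
  have D_bij: "D v x ` J = J" for v x
    using endo_inj_surj[OF _ D_J D_inj] unfolding J_def by simp
  define \<phi> where "\<phi> = (\<lambda>(v, j) (x, y). (op v x, nat ((int y + d v j x) mod ?g)))"
  have phi: "\<phi> (v, j) (x, y) = (op v x, nat ((int y + d v j x) mod ?g))" for v j x y
    unfolding \<phi>_def by simp
  have step_iff: "nat ((int y + d v j x) mod ?g) = y' \<longleftrightarrow> D v x j = (int y' - int y) mod ?g"
    if "y < g" "y' < g" for v j x y y'
  proof -
    have "nat ((int y + d v j x) mod ?g) = y' \<longleftrightarrow> (int y + d v j x) mod ?g = int y' mod ?g"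
      using that by (auto simp: nat_eq_iff)
    also have "\<dots> \<longleftrightarrow> ?g dvd (int y + d v j x) - int y'" by (rule mod_eq_dvd_iff)
    also have "\<dots> \<longleftrightarrow> ?g dvd d v j x - (int y' - int y)" by (simp add: algebra_simps)
    also have "\<dots> \<longleftrightarrow> D v x j = (int y' - int y) mod ?g" unfolding D_def by (rule mod_eq_dvd_iff[symmetric])
    finally show ?thesis .
  qed
  show ?thesis
  proof (rule ARCS_of_permutations[where I = "{..<u} \<times> J" and part = fst and \<phi> = \<phi>])
    show "a * b \<ge> 3" using mult_le_mono[of 1 a 3 b] a(2) b(2) by simp
    show "finite ({..<u} \<times> J)" unfolding J_def by simp
  next
    fix i assume i: "i \<in> {..<u} \<times> J"
    then show "fst i < u" by auto
    obtain v j where vj: "i = (v, j)" "v < u" using i by auto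
    \<comment> \<open>The lift lives on integer residues, the tensor product on natural numbers;
      conjugation by this bijection carries the cycles over.\<close>
    have "bij_betw (\<lambda>(x, y). (x, nat y)) (({..<u} - {v}) \<times> {0..<?g}) {p \<in> {..<u} \<times> {..<g}. fst p \<noteq> v}"
      by (rule bij_betw_byWitness[where f' = "\<lambda>(x, y). (x, int y)"]) auto
    then show "regular_cyc (a * b) (\<phi> i) {p \<in> {..<u} \<times> {..<g}. fst p \<noteq> fst i}"
      unfolding vj(1) fst_conv
      by (rule regular_cyc_conj[OF reg_lift[OF vj(2)]]) (auto simp: phi)
  next
    fix i p assume i: "i \<in> {..<u} \<times> J" and p: "p \<in> {p \<in> {..<u} \<times> {..<g}. fst p \<noteq> fst i}"
    obtain v j where vj: "i = (v, j)" "v < u" "j \<in> J" using i by auto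
    obtain x y where xy: "p = (x, y)" "x < u" "y < g" "x \<noteq> v" using p vj by auto
    have "op v x \<noteq> x" using near_cyclic_closed[OF nc a2, of v x] vj xy by auto
    moreover have "D v x j \<noteq> 0" using D_J[of v x] vj(3) unfolding J_def by force
    then have "nat ((int y + d v j x) mod ?g) \<noteq> y" using step_iff[OF xy(3) xy(3)] by simp
    ultimately show "fst (\<phi> i p) \<noteq> fst p \<and> snd (\<phi> i p) \<noteq> snd p" by (simp add: vj(1) xy(1) phi)
  next
    fix p q assume p: "p \<in> {..<u} \<times> {..<g}" and q: "q \<in> {..<u} \<times> {..<g}"
      and ne: "fst p \<noteq> fst q" "snd p \<noteq> snd q"
    obtain x y where xy: "p = (x, y)" "x < u" "y < g" using p by auto
    obtain x' y' where xy': "q = (x', y')" "x' < u" "y' < g" using q by auto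
    have ex1: "\<exists>!v. v \<in> {..<u} - {x} \<and> op v x = x'"
      by (rule near_cyclic_arc_unique[OF nc a2]) (use xy xy' ne in simp_all)
    then obtain v where v: "v \<in> {..<u} - {x}" "op v x = x'" by blast
    have "(int y' - int y) mod ?g \<noteq> 0"
    proof
      assume "(int y' - int y) mod ?g = 0"
      then have "int y' mod ?g = int y mod ?g" by (simp add: mod_eq_dvd_iff mod_0_imp_dvd)
      then show False using xy xy' ne by simp
    qed
    then have "(int y' - int y) mod ?g \<in> J"
      using pos_mod_bound[OF g0, of "int y' - int y"] pos_mod_sign[OF g0, of "int y' - int y"]
      unfolding J_def by simp
    then obtain j where j: "j \<in> J" "D v x j = (int y' - int y) mod ?g" using D_bij[of v x] by (metis imageE)
    show "\<exists>!i. i \<in> {..<u} \<times> J \<and> p \<in> {p \<in> {..<u} \<times> {..<g}. fst p \<noteq> fst i} \<and> \<phi> i p = q"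
    proof (rule ex1I[of _ "(v, j)"])
      show "(v, j) \<in> {..<u} \<times> J \<and> p \<in> {p \<in> {..<u} \<times> {..<g}. fst p \<noteq> fst (v, j)} \<and> \<phi> (v, j) p = q"
        using v j xy xy' step_iff[OF xy(3) xy'(3)] by (auto simp: phi)
    next
      fix i assume *: "i \<in> {..<u} \<times> J \<and> p \<in> {p \<in> {..<u} \<times> {..<g}. fst p \<noteq> fst i} \<and> \<phi> i p = q"
      obtain w l where i: "i = (w, l)" by (cases i)
      have "w \<in> {..<u} - {x} \<and> op w x = x'" using * by (auto simp: i phi xy(1) xy'(1))
      then have w: "w = v" using ex1 v by blast
      have "D v x l = D v x j"
        using * step_iff[OF xy(3) xy'(3)] j by (auto simp: i phi xy(1) xy'(1) w)
      moreover have "l \<in> J" using * by (simp add: i)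
      ultimately have "l = j" using inj_onD[OF D_inj _ _ j(1)] by blast
      then show "i = (v, j)" using i w by simp
    qed
  qed
qed

section \<open>Near-factorizations from difference families\<close>

lemma near_cyclic_transfer:
  assumes nc: "near_cyclic a V op" and h: "bij_betw h V V'"
  shows "\<exists>op'. near_cyclic a V' op'"
proof -
  define k where "k = inv_into V h"
  have kh: "k (h x) = x" if "x \<in> V" for x
    unfolding k_def using that h by (simp add: bij_betw_def)
  have hk: "h (k y) = y" "k y \<in> V" if "y \<in> V'" for y
    unfolding k_def using that h by (auto simp: bij_betw_def f_inv_into_f inv_into_into)
  define op' where "op' v x = h (op (k v) (k x))" for v x
  have "finite V" using nc by (simp add: near_cyclic_def)
  then have fin: "finite V'" using bij_betw_finite[OF h] by simp
  have reg: "regular_cyc a (op' v) (V' - {v})" if v: "v \<in> V'" for v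
  proof (rule regular_cyc_conj)
    show "regular_cyc a (op (k v)) (V - {k v})" using nc hk(2)[OF v] by (simp add: near_cyclic_def)
    show "bij_betw h (V - {k v}) (V' - {v})"
    proof (rule bij_betw_DiffI[OF h])
      show "bij_betw h {k v} {v}" using hk(1)[OF v] by (simp add: bij_betw_def)
    qed (use hk(2)[OF v] v in simp_all)
    show "op' v (h x) = h (op (k v) x)" if "x \<in> V - {k v}" for x
      using that by (simp add: op'_def kh)
  qed
  have inj: "inj_on (\<lambda>v. op' v x) (V' - {x})" if x: "x \<in> V'" for x
  proof (rule inj_onI)
    fix v w assume vw: "v \<in> V' - {x}" "w \<in> V' - {x}" "op' v x = op' w x"
    have inj: "inj_on (\<lambda>v. op v (k x)) (V - {k x})" using nc hk[OF x] by (simp add: near_cyclic_def)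
    have kv: "k y \<in> V - {k x}" if y: "y \<in> V' - {x}" for y
    proof -
      have "y \<in> V'" "y \<noteq> x" using y by simp_all
      then have "h (k y) \<noteq> h (k x)" using hk(1)[OF x] hk(1)[of y] by simp
      then have "k y \<noteq> k x" by (rule contrapos_nn) simp
      then show ?thesis using hk(2)[OF \<open>y \<in> V'\<close>] by simp
    qed
    have clo: "op (k y) (k x) \<in> V" if "y \<in> V' - {x}" for y
    proof -
      have "regular_cyc a (op (k y)) (V - {k y})" using nc kv[OF that] by (simp add: near_cyclic_def)
      moreover have "k x \<in> V - {k y}" using kv[OF that] hk(2)[OF x] by (metis DiffD2 DiffI singletonD singletonI)
      ultimately have "op (k y) (k x) \<in> V - {k y}" by (rule regular_cyc_closed)
      then show ?thesis by simp
    qed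
    have "k (op' v x) = k (op' w x)" using vw(3) by simp
    then have "op (k v) (k x) = op (k w) (k x)"
      unfolding op'_def kh[OF clo[OF vw(1)]] kh[OF clo[OF vw(2)]] .
    then have "k v = k w" using inj_on_eq_iff[OF inj kv[OF vw(1)] kv[OF vw(2)]] by simp
    then have "h (k v) = h (k w)" by (rule arg_cong)
    moreover have "h (k v) = v" "h (k w) = w" using hk(1)[of v] hk(1)[of w] vw(1,2) by blast+
    ultimately show "v = w" by metis
  qed
  show ?thesis
    unfolding near_cyclic_def by (intro exI[of _ op'] conjI ballI fin reg inj)
qed

text \<open>Only the number of points matters, since the structure transfers along
  bijections.\<close>

definition has_near_cyclic :: "nat \<Rightarrow> nat \<Rightarrow> bool" where
  "has_near_cyclic a n \<longleftrightarrow> (\<exists>op. near_cyclic a {..<n} op)"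

lemma has_near_cyclicI:
  assumes "near_cyclic a V op" "card V = n"
  shows "has_near_cyclic a n"
proof -
  have "finite V" using assms by (simp add: near_cyclic_def)
  then obtain h where "bij_betw h V {..<n}"
    using finite_same_card_bij[of V "{..<n}"] assms(2) by auto
  then show ?thesis unfolding has_near_cyclic_def using near_cyclic_transfer[OF assms(1)] by blast
qed

lemma has_near_cyclicD:
  assumes "has_near_cyclic a n" "finite V" "card V = n"
  shows "\<exists>op. near_cyclic a V op"
proof -
  obtain op where nc: "near_cyclic a {..<n} op" using assms(1) unfolding has_near_cyclic_def by blast
  obtain h where "bij_betw h {..<n} V"
    using finite_same_card_bij[of "{..<n}" V] assms(2,3) by auto
  then show ?thesis using near_cyclic_transfer[OF nc] by blast
qed

section \<open>Cycles given by vertex labels and their differences\<close>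

lemma regular_cyc_shift:
  assumes "a > 0"
  shows "regular_cyc a (\<lambda>(c, i). (c, Suc i mod a)) (C \<times> {..<a})"
  unfolding regular_cyc_def
proof (intro ballI conjI allI)
  let ?s = "\<lambda>(c, i). (c, Suc i mod a)"
  fix z assume "z \<in> C \<times> {..<a}"
  then obtain c i where z: "z = (c, i)" "c \<in> C" "i < a" by auto
  show "?s z \<in> C \<times> {..<a}" using z assms by simp
  fix j
  have "(?s ^^ j) z = (c, (i + j) mod a)"
    by (induction j) (use z in \<open>simp_all add: mod_Suc_eq\<close>)
  moreover have "(i + j) mod a = i \<longleftrightarrow> a dvd j"
    using z(3) mod_eq_dvd_iff_nat[of i "i + j" a] by simp
  ultimately show "(?s ^^ j) z = z \<longleftrightarrow> a dvd j" by (simp add: z(1))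
qed

text \<open>Here \<open>e v (c, i)\<close> is the vertex at position \<open>i\<close> of cycle
  \<open>c\<close> in the near-factor missing \<open>v\<close>. Counting makes \<open>e v\<close> a
  bijection onto \<open>V - {v}\<close>, so the cyclic shift of positions can be conjugated to a
  successor map.\<close>

lemma near_cyclic_of_cycles:
  fixes e :: "'v \<Rightarrow> 'c \<times> nat \<Rightarrow> 'v"
  assumes fin: "finite V" "finite C" and a: "a > 0" and card: "card V = card C * a + 1"
    and inj: "\<And>v. v \<in> V \<Longrightarrow> inj_on (e v) (C \<times> {..<a})"
    and mem: "\<And>v p. v \<in> V \<Longrightarrow> p \<in> C \<times> {..<a} \<Longrightarrow> e v p \<in> V - {v}"
    and arc: "\<And>v w c i c' i'. \<lbrakk>v \<in> V; w \<in> V; c \<in> C; c' \<in> C; i < a; i' < a;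
      e v (c, i) = e w (c', i'); e v (c, Suc i mod a) = e w (c', Suc i' mod a)\<rbrakk> \<Longrightarrow> v = w"
  shows "\<exists>op. near_cyclic a V op"
proof -
  have bij: "bij_betw (e v) (C \<times> {..<a}) (V - {v})" if v: "v \<in> V" for v
    unfolding bij_betw_def
  proof
    show "inj_on (e v) (C \<times> {..<a})" using inj[OF v] .
    have "card (e v ` (C \<times> {..<a})) = card (V - {v})"
      using card_image[OF inj[OF v]] card v fin by (simp add: card_cartesian_product)
    moreover have "e v ` (C \<times> {..<a}) \<subseteq> V - {v}" using mem[OF v] by (rule image_subsetI)
    ultimately show "e v ` (C \<times> {..<a}) = V - {v}"
      using fin by (intro card_subset_eq) simp_all
  qed
  define s where "s = (\<lambda>(c, i). (c, Suc i mod a) :: 'c \<times> nat)"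
  define op where "op v x = e v (s (inv_into (C \<times> {..<a}) (e v) x))" for v x
  have op: "op v (e v p) = e v (s p)" if "v \<in> V" "p \<in> C \<times> {..<a}" for v p
    unfolding op_def using inj that by (simp add: inv_into_f_f)
  have reg: "regular_cyc a (op v) (V - {v})" if "v \<in> V" for v
    by (rule regular_cyc_conj[OF regular_cyc_shift[OF a] bij[OF that], folded s_def])
      (rule op[OF that])
  have inj': "inj_on (\<lambda>v. op v x) (V - {x})" if x: "x \<in> V" for x
  proof (rule inj_onI)
    fix v w assume vw: "v \<in> V - {x}" "w \<in> V - {x}" "op v x = op w x"
    have label: "\<exists>c i. x = e v (c, i) \<and> c \<in> C \<and> i < a" if "v \<in> V - {x}" for v
    proof -
      have "x \<in> e v ` (C \<times> {..<a})" using bij[of v] that x unfolding bij_betw_def by auto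
      then show ?thesis by auto
    qed
    obtain c i where ci: "x = e v (c, i)" "c \<in> C" "i < a" using label[OF vw(1)] by blast
    obtain c' i' where ci': "x = e w (c', i')" "c' \<in> C" "i' < a" using label[OF vw(2)] by blast
    have "op v x = e v (c, Suc i mod a)" using op[of v "(c, i)"] vw(1) ci by (simp add: s_def)
    moreover have "op w x = e w (c', Suc i' mod a)" using op[of w "(c', i')"] vw(2) ci' by (simp add: s_def)
    ultimately have "e v (c, Suc i mod a) = e w (c', Suc i' mod a)" using vw(3) by simp
    moreover have "e v (c, i) = e w (c', i')" using ci(1) ci'(1) by simp
    ultimately show "v = w" using arc[of v w c c' i i'] vw ci ci' by simp
  qed
  show ?thesis
    unfolding near_cyclic_def by (intro exI[of _ op] conjI ballI fin(1) reg inj')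
qed

lemma int_eqI_of_dvd:
  fixes N x y :: int
  assumes "N dvd x - y" "\<bar>x - y\<bar> < N"
  shows "x = y"
  using assms dvd_imp_le_int[of "x - y" N] by fastforce

text \<open>The base cycles are translated through the integers modulo \<open>N\<close>. Distinct
  nonzero labels make every translate span all points but \<open>v\<close>; distinct differences
  make an arc reveal its position in the base cycles, and then \<open>v\<close>.\<close>

lemma near_cyclic_of_difference_family:
  fixes N :: int and \<delta> :: "'c \<times> nat \<Rightarrow> int"
  assumes fin: "finite C" and a: "a > 0" and N: "N = int (card C * a + 1)"
    and label: "\<And>p q. p \<in> C \<times> {..<a} \<Longrightarrow> q \<in> C \<times> {..<a} \<Longrightarrow> N dvd \<delta> p - \<delta> q \<Longrightarrow> p = q"
    and nonzero: "\<And>p. p \<in> C \<times> {..<a} \<Longrightarrow> \<not> N dvd \<delta> p"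
    and diff: "\<And>c i c' i'. \<lbrakk>c \<in> C; c' \<in> C; i < a; i' < a;
      N dvd (\<delta> (c, Suc i mod a) - \<delta> (c, i)) - (\<delta> (c', Suc i' mod a) - \<delta> (c', i'))\<rbrakk>
      \<Longrightarrow> (c, i) = (c', i')"
  shows "has_near_cyclic a (card C * a + 1)"
proof -
  have N0: "N > 0" unfolding N by (simp only: of_nat_0_less_iff)
  define e where "e v p = (v + \<delta> p) mod N" for v p
  have eD: "N dvd (v + \<delta> p) - (w + \<delta> q)" if "e v p = e w q" for v w p q
    using that unfolding e_def by (rule mod_eq_dvd_iff[THEN iffD1])
  have eq: "v = w" if "N dvd v - w" "v \<in> {0..<N}" "w \<in> {0..<N}" for v w
    using that by (intro int_eqI_of_dvd[of N]) auto
  have "\<exists>op. near_cyclic a {0..<N} op"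
  proof (rule near_cyclic_of_cycles[where e = e])
    show "finite {0..<N}" "finite C" "a > 0" using fin a by simp_all
    show "card {0..<N} = card C * a + 1" by (simp only: N card_atLeastLessThan_int diff_zero nat_int)
    show "inj_on (e v) (C \<times> {..<a})" for v
    proof (rule inj_onI)
      fix p q assume pq: "p \<in> C \<times> {..<a}" "q \<in> C \<times> {..<a}" "e v p = e v q"
      have "N dvd \<delta> p - \<delta> q" using eD[OF pq(3)] by simp
      then show "p = q" using label pq(1,2) by blast
    qed
    show "e v p \<in> {0..<N} - {v}" if "v \<in> {0..<N}" "p \<in> C \<times> {..<a}" for v p
    proof -
      have "e v p \<noteq> v"
      proof
        assume "e v p = v"
        then have "(v + \<delta> p) mod N = v mod N" unfolding e_def using that by simp
        then have "N dvd \<delta> p" by (simp add: mod_eq_dvd_iff)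
        then show False using nonzero that by blast
      qed
      then show ?thesis unfolding e_def using N0 by simp
    qed
    fix v w c i c' i' assume *: "v \<in> {0..<N}" "w \<in> {0..<N}" "c \<in> C" "c' \<in> C" "i < a" "i' < a"
      "e v (c, i) = e w (c', i')" "e v (c, Suc i mod a) = e w (c', Suc i' mod a)"
    \<comment> \<open>Subtracting the congruences for the two ends of a common arc eliminates
      \<open>v\<close> and \<open>w\<close>.\<close>
    have "N dvd ((v + \<delta> (c, Suc i mod a)) - (w + \<delta> (c', Suc i' mod a))) - ((v + \<delta> (c, i)) - (w + \<delta> (c', i')))"
      using eD[OF *(8)] eD[OF *(7)] by (rule dvd_diff)
    then have "N dvd (\<delta> (c, Suc i mod a) - \<delta> (c, i)) - (\<delta> (c', Suc i' mod a) - \<delta> (c', i'))"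
      by (simp add: algebra_simps)
    then have "(c, i) = (c', i')" by (rule diff[OF *(3-6)])
    then have "N dvd v - w" using eD[OF *(7)] by simp
    then show "v = w" using eq *(1,2) by blast
  qed
  then obtain op where "near_cyclic a {0..<N} op" by blast
  then show ?thesis by (rule has_near_cyclicI) (simp only: N card_atLeastLessThan_int diff_zero nat_int)
qed

section \<open>Explicit near-factorizations\<close>

text \<open>The base cycles are the pairs \<open>c\<close>, \<open>- c\<close>. Their differences
  are twice the negated labels, hence distinct modulo an odd number.\<close>

lemma has_near_cyclic_2: "has_near_cyclic 2 (2 * s + 1)"
proof -
  define \<delta> :: "nat \<times> nat \<Rightarrow> int" where "\<delta> = (\<lambda>(c, i). if i = 0 then int c else - int c)"
  let ?N = "int (card {1..s} * 2 + 1)"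
  have range: "\<bar>\<delta> p\<bar> \<le> int s" "\<delta> p \<noteq> 0" if "p \<in> {1..s} \<times> {..<2}" for p
    using that by (auto simp: \<delta>_def split: if_splits)
  have eq: "p = q" if "p \<in> {1..s} \<times> {..<2}" "q \<in> {1..s} \<times> {..<2}" "?N dvd \<delta> p - \<delta> q" for p q
  proof -
    have "\<delta> p = \<delta> q" using that(3) range[OF that(1)] range[OF that(2)]
      by (intro int_eqI_of_dvd[of ?N]) auto
    then show ?thesis using that(1,2) by (auto simp: \<delta>_def split: if_splits)
  qed
  have "has_near_cyclic 2 (card {1..s} * 2 + 1)"
  proof (rule near_cyclic_of_difference_family[where \<delta> = \<delta>, OF _ _ refl])
    show "p = q" if "p \<in> {1..s} \<times> {..<2}" "q \<in> {1..s} \<times> {..<2}" "?N dvd \<delta> p - \<delta> q" for p q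
      using that by (rule eq)
    show "\<not> ?N dvd \<delta> p" if "p \<in> {1..s} \<times> {..<2}" for p
      using range[OF that] dvd_imp_le_int[of "\<delta> p" ?N] by auto
    fix c i c' i' :: nat
    assume *: "c \<in> {1..s}" "c' \<in> {1..s}" "i < 2" "i' < 2"
      "?N dvd (\<delta> (c, Suc i mod 2) - \<delta> (c, i)) - (\<delta> (c', Suc i' mod 2) - \<delta> (c', i'))"
    have "\<delta> (c, Suc i mod 2) - \<delta> (c, i) = - (2 * \<delta> (c, i))" if "i < 2" for c i
      using that by (auto simp: \<delta>_def less_2_cases_iff)
    then have "?N dvd 2 * (\<delta> (c', i') - \<delta> (c, i))" using * by (simp add: algebra_simps)
    moreover have "coprime ?N 2" by simp
    ultimately have "?N dvd \<delta> (c', i') - \<delta> (c, i)" using coprime_dvd_mult_right_iff by blast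
    then show "(c, i) = (c', i')" using eq[of "(c', i')" "(c, i)"] * by simp
  qed simp_all
  then show ?thesis by (simp add: mult.commute)
qed

text \<open>The negative of a cycle repeats its differences with the opposite sign, so it suffices that
  one cycle has all absolute values and, up to sign, all differences exactly once.\<close>

lemma has_near_cyclic_of_signed_cycle:
  fixes v c :: "nat \<Rightarrow> int"
  assumes h: "h > 0"
    and v: "\<And>i. i < 2 * h \<Longrightarrow> 1 \<le> \<bar>v i\<bar> \<and> \<bar>v i\<bar> \<le> 2 * int h"
    and v_inj: "inj_on (\<lambda>i. \<bar>v i\<bar>) {..<2 * h}"
    and c: "\<And>i. i < 2 * h \<Longrightarrow> 1 \<le> c i \<and> c i \<le> 2 * int h"
    and c_inj: "inj_on c {..<2 * h}"
    and diff: "\<And>i. i < 2 * h \<Longrightarrow> \<exists>\<epsilon>\<in>{1, -1}. 4 * int h + 1 dvd v (Suc i mod (2 * h)) - v i - \<epsilon> * c i"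
  shows "has_near_cyclic (2 * h) (4 * h + 1)"
proof -
  define \<delta> where "\<delta> = (\<lambda>(\<sigma>, i). \<sigma> * v i)"
  let ?S = "{1, -1} :: int set"
  let ?N = "4 * int h + 1"
  have sgn: "\<sigma> * x = x \<or> \<sigma> * x = - x" if "\<sigma> \<in> ?S" for \<sigma> x :: int using that by auto
  have "has_near_cyclic (2 * h) (card ?S * (2 * h) + 1)"
  proof (rule near_cyclic_of_difference_family[where N = ?N and \<delta> = \<delta>])
    show "finite ?S" "2 * h > 0" "?N = int (card ?S * (2 * h) + 1)" using h by simp_all
  next
    fix p q assume pq: "p \<in> ?S \<times> {..<2 * h}" "q \<in> ?S \<times> {..<2 * h}" "?N dvd \<delta> p - \<delta> q"
    obtain \<sigma> i where p: "p = (\<sigma>, i)" "\<sigma> \<in> ?S" "i < 2 * h" using pq(1) by blast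
    obtain \<rho> j where q: "q = (\<rho>, j)" "\<rho> \<in> ?S" "j < 2 * h" using pq(2) by blast
    have eq: "\<sigma> * v i = \<rho> * v j"
      using pq(3) v[OF p(3)] v[OF q(3)] sgn[OF p(2), of "v i"] sgn[OF q(2), of "v j"]
      unfolding p(1) q(1) \<delta>_def prod.case by (intro int_eqI_of_dvd[of ?N]) linarith+
    then have "\<bar>v i\<bar> = \<bar>v j\<bar>" using sgn[OF p(2), of "v i"] sgn[OF q(2), of "v j"] by linarith
    then have "i = j" using p(3) q(3) by (intro inj_onD[OF v_inj]) simp_all
    moreover have "v i \<noteq> 0" using v[OF p(3)] by linarith
    ultimately show "p = q" using eq by (simp add: p(1) q(1))
  next
    fix p assume p: "p \<in> ?S \<times> {..<2 * h}"
    then obtain \<sigma> i where p: "p = (\<sigma>, i)" "\<sigma> \<in> ?S" "i < 2 * h" by blast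
    show "\<not> ?N dvd \<delta> p"
    proof
      assume "?N dvd \<delta> p"
      then have "?N dvd \<sigma> * v i - 0" by (simp add: p \<delta>_def)
      then have "\<sigma> * v i = 0" using v[OF p(3)] sgn[OF p(2), of "v i"]
        by (intro int_eqI_of_dvd[of ?N]) linarith+
      then show False using v[OF p(3)] sgn[OF p(2), of "v i"] by linarith
    qed
  next
    fix \<sigma> i \<rho> j assume *: "\<sigma> \<in> ?S" "\<rho> \<in> ?S" "i < 2 * h" "j < 2 * h"
      "?N dvd (\<delta> (\<sigma>, Suc i mod (2 * h)) - \<delta> (\<sigma>, i)) - (\<delta> (\<rho>, Suc j mod (2 * h)) - \<delta> (\<rho>, j))"
    let ?D = "\<lambda>i. v (Suc i mod (2 * h)) - v i"
    have dvd: "?N dvd \<sigma> * ?D i - \<rho> * ?D j" using *(5) by (simp add: \<delta>_def algebra_simps)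
    obtain \<epsilon> where e: "\<epsilon> \<in> ?S" "?N dvd ?D i - \<epsilon> * c i" using diff[OF *(3)] by blast
    obtain \<epsilon>' where e': "\<epsilon>' \<in> ?S" "?N dvd ?D j - \<epsilon>' * c j" using diff[OF *(4)] by blast
    \<comment> \<open>Both differences are replaced by their signed representatives, which are small
      enough for congruence to become equality.\<close>
    have "?N dvd (\<sigma> * ?D i - \<rho> * ?D j) - \<sigma> * (?D i - \<epsilon> * c i) + \<rho> * (?D j - \<epsilon>' * c j)"
      by (rule dvd_add[OF dvd_diff[OF dvd dvd_mult[OF e(2)]] dvd_mult[OF e'(2)]])
    then have "?N dvd \<sigma> * (\<epsilon> * c i) - \<rho> * (\<epsilon>' * c j)" by (simp add: algebra_simps)
    moreover have "\<bar>\<sigma> * (\<epsilon> * c i)\<bar> = c i" "\<bar>\<rho> * (\<epsilon>' * c j)\<bar> = c j"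
      using * e e' c[OF *(3)] c[OF *(4)] by (auto simp: abs_mult)
    ultimately have eq: "\<sigma> * (\<epsilon> * c i) = \<rho> * (\<epsilon>' * c j)"
      using c[OF *(3)] c[OF *(4)] by (intro int_eqI_of_dvd[of ?N]) linarith+
    then have "c i = c j"
      using \<open>\<bar>\<sigma> * (\<epsilon> * c i)\<bar> = c i\<close> \<open>\<bar>\<rho> * (\<epsilon>' * c j)\<bar> = c j\<close> by simp
    then have ij: "i = j" using *(3,4) by (intro inj_onD[OF c_inj]) simp_all
    \<comment> \<open>Opposite signs at the same position would make twice a difference vanish
      modulo the odd number \<open>?N\<close>, although \<open>c i\<close> is nonzero there.\<close>
    have "\<sigma> = \<rho>"
    proof (rule ccontr)
      assume "\<sigma> \<noteq> \<rho>"
      then have "\<rho> = - \<sigma>" using *(1,2) by auto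
      then have "?N dvd 2 * (\<sigma> * ?D i)" using dvd ij by (simp add: algebra_simps)
      moreover have "coprime ?N 2" by simp
      ultimately have "?N dvd \<sigma> * ?D i" using coprime_dvd_mult_right_iff by blast
      from dvd_diff[OF this dvd_mult[OF e(2), of \<sigma>]] have "?N dvd \<sigma> * (\<epsilon> * c i) - 0" by (simp add: algebra_simps)
      then have "\<sigma> * (\<epsilon> * c i) = 0"
        using c[OF *(3)] \<open>\<bar>\<sigma> * (\<epsilon> * c i)\<bar> = c i\<close> by (intro int_eqI_of_dvd[of ?N]) linarith+
      then show False using c[OF *(3)] \<open>\<bar>\<sigma> * (\<epsilon> * c i)\<bar> = c i\<close> by linarith
    qed
    then show "(\<sigma>, i) = (\<rho>, j)" using ij by simp
  qed
  then show ?thesis by simp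
qed

text \<open>The zigzag \<open>1, 2h, 2, 2h - 1, \<dots>\<close> has the differences \<open>2h - 1, \<dots>, 1\<close> and its closing edge
  repeats \<open>h\<close>; negating a segment turns its two boundary differences into sums, which repairs this
  modulo \<open>4h + 1\<close>.\<close>

lemma has_near_cyclic_two_blocks:
  assumes h: "h \<ge> 2"
  shows "has_near_cyclic (2 * h) (4 * h + 1)"
proof -
  define w where "w i = (if even i then int (i div 2) + 1 else 2 * int h - int (i div 2))" for i
  have w_range: "1 \<le> w i \<and> w i \<le> 2 * int h" if "i < 2 * h" for i
    using that unfolding w_def by auto
  have w_inj: "i = j" if "i < 2 * h" "j < 2 * h" "w i = w j" for i j
    using that unfolding w_def by (auto elim!: evenE oddE split: if_splits)
  \<comment> \<open>Differences of neighbours run down from \<open>2 * h - 1\<close>, while their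
    sums alternate between \<open>2 * h + 1\<close> and \<open>2 * h + 2\<close>.\<close>
  have w_Suc: "w (Suc i) = w i + (if even i then 1 else -1) * (2 * int h - 1 - int i)"
    and w_sum: "w (Suc i) + w i = 2 * int h + (if even i then 1 else 2)" if "i < 2 * h" for i
    using that unfolding w_def by (auto elim!: evenE oddE)
  have w_0: "w 0 = 1" and w_last: "w (2 * h - 1) = int h + 1"
    using h unfolding w_def by (auto simp: of_nat_diff)
  have last: "Suc i mod (2 * h) = (if i = 2 * h - 1 then 0 else Suc i)" if "i < 2 * h" for i
    using that by auto
  show ?thesis
  proof (cases "even h")
    case True
    \<comment> \<open>Negating positions 1 to \<open>h - 1\<close> removes the differences
      \<open>2 * h - 1\<close> and \<open>h\<close>. The boundary sums \<open>2 * h + 1\<close> and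
      \<open>2 * h + 2\<close> supply \<open>2 * h\<close> and \<open>2 * h - 1\<close> up to sign,
      and the closing edge supplies \<open>h\<close>.\<close>
    define v where "v i = (if 1 \<le> i \<and> i < h then - w i else w i)" for i
    define c where "c i = (if i = 0 then 2 * int h else if i = h - 1 then 2 * int h - 1
      else if i = 2 * h - 1 then int h else 2 * int h - 1 - int i)" for i
    show ?thesis
    proof (rule has_near_cyclic_of_signed_cycle[where v = v and c = c])
      show "h > 0" using h by simp
      show "1 \<le> \<bar>v i\<bar> \<and> \<bar>v i\<bar> \<le> 2 * int h" if "i < 2 * h" for i
        using w_range[OF that] unfolding v_def by auto
      show "inj_on (\<lambda>i. \<bar>v i\<bar>) {..<2 * h}"
      proof (rule inj_onI)
        fix i j assume ij: "i \<in> {..<2 * h}" "j \<in> {..<2 * h}" "\<bar>v i\<bar> = \<bar>v j\<bar>"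
        then have "w i = w j" using w_range[of i] w_range[of j] by (auto simp: v_def split: if_splits)
        then show "i = j" using w_inj[of i j] ij by simp
      qed
      show "1 \<le> c i \<and> c i \<le> 2 * int h" if "i < 2 * h" for i
        using that h unfolding c_def by auto
      show "inj_on c {..<2 * h}"
        using h unfolding c_def by (intro inj_onI) (auto split: if_splits)
      fix i assume i: "i < 2 * h"
      let ?D = "v (Suc i mod (2 * h)) - v i"
      consider "i = 0" | "i = h - 1" "i > 0" | "i = 2 * h - 1" | "i \<noteq> 0" "i \<noteq> h - 1" "i \<noteq> 2 * h - 1" by blast
      then show "\<exists>\<epsilon>\<in>{1, -1}. 4 * int h + 1 dvd ?D - \<epsilon> * c i"
      proof cases
        case 1
        have "?D - 1 * c i = - (4 * int h + 1)"
          using 1 h w_sum[of 0] by (simp add: v_def c_def w_0)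
        then show ?thesis by (metis dvd_minus_iff dvd_refl insertI1)
      next
        case 2
        have "odd i" using 2 True h by simp
        then have "?D - (- 1) * c i = 4 * int h + 1"
          using 2 h w_sum[OF i] last[OF i] by (auto simp: v_def c_def)
        then show ?thesis by (metis dvd_refl insertI1 insertI2)
      next
        case 3
        have "?D - (- 1) * c i = 0"
          using 3 h w_0 w_last last[OF i] by (auto simp: v_def c_def)
        then show ?thesis by (metis dvd_0_right insertI1 insertI2)
      next
        case 4
        then have "Suc i mod (2 * h) = Suc i" "(1 \<le> Suc i \<and> Suc i < h) = (1 \<le> i \<and> i < h)"
          using last[OF i] by auto
        then have "?D = 1 * c i \<or> ?D = (- 1) * c i"
          using 4 w_Suc[OF i] by (auto simp: v_def c_def)
        then show ?thesis by (metis dvd_0_right diff_self insertI1 insertI2)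
      qed
    qed
  next
    case False
    then have h3: "h \<ge> 3" using h by (cases "h = 2") auto
    \<comment> \<open>The negated segment runs from position \<open>h - 2\<close> to the end, so the
      closing edge is one of its boundaries and becomes the sum \<open>h + 2\<close>. The other
      boundary trades \<open>h + 2\<close> for \<open>2 * h\<close>.\<close>
    define v where "v i = (if h \<le> i + 2 then - w i else w i)" for i
    define c where "c i = (if i + 3 = h then 2 * int h else if Suc i = 2 * h then int h + 2
      else 2 * int h - 1 - int i)" for i
    show ?thesis
    proof (rule has_near_cyclic_of_signed_cycle[where v = v and c = c])
      show "h > 0" using h by simp
      show "1 \<le> \<bar>v i\<bar> \<and> \<bar>v i\<bar> \<le> 2 * int h" if "i < 2 * h" for i
        using w_range[OF that] unfolding v_def by auto
      show "inj_on (\<lambda>i. \<bar>v i\<bar>) {..<2 * h}"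
      proof (rule inj_onI)
        fix i j assume ij: "i \<in> {..<2 * h}" "j \<in> {..<2 * h}" "\<bar>v i\<bar> = \<bar>v j\<bar>"
        then have "w i = w j" using w_range[of i] w_range[of j] by (auto simp: v_def split: if_splits)
        then show "i = j" using w_inj[of i j] ij by simp
      qed
      show "1 \<le> c i \<and> c i \<le> 2 * int h" if "i < 2 * h" for i
        using that h3 unfolding c_def by auto
      show "inj_on c {..<2 * h}"
        using h3 unfolding c_def by (intro inj_onI) (auto split: if_splits)
      fix i assume i: "i < 2 * h"
      let ?D = "v (Suc i mod (2 * h)) - v i"
      consider "i + 3 = h" | "Suc i = 2 * h" | "i + 3 \<noteq> h" "Suc i \<noteq> 2 * h" by blast
      then show "\<exists>\<epsilon>\<in>{1, -1}. 4 * int h + 1 dvd ?D - \<epsilon> * c i"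
      proof cases
        case 1
        have "even i" using 1 False by presburger
        then have "?D - 1 * c i = - (4 * int h + 1)"
          using 1 h3 w_sum[OF i] last[OF i] by (auto simp: v_def c_def)
        then show ?thesis by (metis dvd_minus_iff dvd_refl insertI1)
      next
        case 2
        then have "i = 2 * h - 1" by simp
        then have "?D - 1 * c i = 0"
          using h3 w_0 w_last last[OF i] by (auto simp: v_def c_def)
        then show ?thesis by (metis dvd_0_right insertI1)
      next
        case 3
        then have "Suc i mod (2 * h) = Suc i" "h \<le> Suc i + 2 \<longleftrightarrow> h \<le> i + 2"
          using last[OF i] by auto
        then have "?D = 1 * c i \<or> ?D = (- 1) * c i"
          using 3 w_Suc[OF i] by (auto simp: v_def c_def)
        then show ?thesis by (metis dvd_0_right diff_self insertI1 insertI2)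
      qed
    qed
  qed
qed

text \<open>The vertices other than \<open>Some x\<close> form the cycle \<open>None, x + 1, x - 1, x + 2, x - 2, \<dots>\<close>; its
  directed differences are all nonzero residues except 1, which is left for the cycle avoiding
  \<open>None\<close>.\<close>

lemma has_near_cyclic_one_block:
  assumes h: "h > 0"
  shows "has_near_cyclic (2 * h) (2 * h + 1)"
proof -
  define M where "M = 2 * int h"
  have M0: "M > 0" using h by (simp add: M_def)
  define w where "w i = (if even i then int (i div 2) + 1 else - (int (i div 2) + 1))" for i
  have w_range: "- int h < w i \<and> w i \<le> int h \<and> w i \<noteq> 0" if "Suc i < 2 * h" for i
    using that unfolding w_def by (auto elim!: evenE oddE)
  have w_inj: "i = j" if "w i = w j" for i j
    using that unfolding w_def by (auto elim!: evenE oddE split: if_splits)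
  define D where "D j = (if even j then - (int j + 2) else int j + 2)" for j
  have w_Suc: "w (Suc j) - w j = D j" for j
    unfolding w_def D_def by (auto elim!: evenE oddE)
  \<comment> \<open>As \<open>M\<close> is even, congruent differences have equal parity, hence
    equal sign, and then they are too close to differ by a multiple of \<open>M\<close>.\<close>
  have D_inj: "j = k" if "M dvd D j - D k" "j + 2 < 2 * h" "k + 2 < 2 * h" for j k
  proof -
    have "even (D j - D k)" using that(1) unfolding M_def by (meson dvd_mult_left)
    then have par: "even j \<longleftrightarrow> even k" unfolding D_def by (auto split: if_splits)
    have "D j = D k" using that(1)
    proof (rule int_eqI_of_dvd)
      show "\<bar>D j - D k\<bar> < M" using par that(2,3) unfolding D_def M_def by auto
    qed
    then show ?thesis using par unfolding D_def by (auto split: if_splits)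
  qed
  have D_not_1: "\<not> M dvd D j - 1" if "j + 2 < 2 * h" for j
  proof
    assume dvd: "M dvd D j - 1"
    then have "even (D j - 1)" unfolding M_def by (meson dvd_mult_left)
    then have "odd j" unfolding D_def by (auto split: if_splits)
    then have D: "D j = int j + 2" unfolding D_def by simp
    then have "D j = 1" using that by (intro int_eqI_of_dvd[OF dvd]) (simp add: M_def)
    then show False using D by simp
  qed
  \<comment> \<open>The cycle missing \<open>None\<close> runs through 0, 1, 2, ... in order; in the
    other cycles \<open>None\<close> sits at position 0, which shifts the zigzag index by
    one.\<close>
  define e where "e v p = (case v of None \<Rightarrow> Some (int (snd p)) |
      Some x \<Rightarrow> if snd p = 0 then None else Some ((x + w (snd p - 1)) mod M))" for v and p :: "unit \<times> nat"
  have e_None: "e None (c, i) = Some (int i)" for c i by (simp add: e_def)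
  have e_Some: "e (Some x) (c, i) = (if i = 0 then None else Some ((x + w (i - 1)) mod M))" for x c i
    by (simp add: e_def)
  have eq: "x = y" if "x \<in> {0..<M}" "y \<in> {0..<M}" "M dvd x - y" for x y
    using that(1,2) by (intro int_eqI_of_dvd[OF that(3)]) auto
  let ?V = "insert None (Some ` {0..<M})"
  \<comment> \<open>All arcs of the cycle missing \<open>None\<close> have difference 1, which the
    zigzag avoids.\<close>
  have mixed: False
    if x: "x \<in> {0..<M}" and i: "i < 2 * h" "i' < 2 * h"
      and e1: "e (Some x) (c, i) = e None (c', i')"
      and e2: "e (Some x) (c, Suc i mod (2 * h)) = e None (c', Suc i' mod (2 * h))" for x i i' c c'
  proof -
    have i0: "i \<noteq> 0" using e1 by (auto simp: e_None e_Some split: if_splits)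
    have "Suc i \<noteq> 2 * h" using e2 by (auto simp: e_None e_Some split: if_splits)
    then have Si: "Suc i mod (2 * h) = Suc i" "Suc i < 2 * h" using i by simp_all
    have "(x + w (i - 1)) mod M = int i' mod M" using e1 i0 i by (simp add: e_None e_Some M_def)
    then have d1: "M dvd (x + w (i - 1)) - int i'" by (simp add: mod_eq_dvd_iff)
    have "(x + w i) mod M = int (Suc i' mod (2 * h))" using e2 i Si by (simp add: e_None e_Some M_def)
    also have "\<dots> = (int i' + 1) mod M" by (simp add: M_def zmod_int add.commute)
    finally have "M dvd (x + w i) - (int i' + 1)" by (simp add: mod_eq_dvd_iff)
    from dvd_diff[OF this d1] have "M dvd (w (Suc (i - 1)) - w (i - 1)) - 1"
      using i0 by (simp add: algebra_simps)
    then show False unfolding w_Suc using D_not_1[of "i - 1"] Si i0 by simp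
  qed
  have "\<exists>op. near_cyclic (2 * h) ?V op"
  proof (rule near_cyclic_of_cycles[where C = "{()}" and e = e])
    show "finite ?V" "finite {()}" "2 * h > 0" using h by simp_all
    show "card ?V = card {()} * (2 * h) + 1"
      by (subst card_insert_disjoint) (auto simp: card_image M_def)
  next
    fix v assume v: "v \<in> ?V"
    show "inj_on (e v) ({()} \<times> {..<2 * h})"
    proof (rule inj_onI)
      fix p q assume p: "p \<in> {()} \<times> {..<2 * h}" and q: "q \<in> {()} \<times> {..<2 * h}" and pq: "e v p = e v q"
      obtain i where i: "p = ((), i)" "i < 2 * h" using p by auto
      obtain j where j: "q = ((), j)" "j < 2 * h" using q by auto
      show "p = q"
      proof (cases v)
        case None
        then show ?thesis using pq by (simp add: i j e_None)
      next
        case (Some x)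
        show ?thesis
        proof (cases "i = 0 \<or> j = 0")
          case True
          then show ?thesis using pq by (auto simp: Some i j e_Some split: if_splits)
        next
          case False
          then have "(x + w (i - 1)) mod M = (x + w (j - 1)) mod M" using pq by (simp add: Some i j e_Some)
          then have "M dvd w (i - 1) - w (j - 1)" by (simp add: mod_eq_dvd_iff)
          then have "w (i - 1) = w (j - 1)"
            using w_range[of "i - 1"] w_range[of "j - 1"] False i j
            by (intro int_eqI_of_dvd[of M]) (auto simp: M_def)
          then have "i - 1 = j - 1" by (rule w_inj)
          then show ?thesis using False i j by auto
        qed
      qed
    qed
    show "e v p \<in> ?V - {v}" if p: "p \<in> {()} \<times> {..<2 * h}" for p
    proof -
      obtain i where i: "p = ((), i)" "i < 2 * h" using p by auto
      show ?thesis
      proof (cases v)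
        case None
        then show ?thesis using i by (simp add: e_None M_def)
      next
        case (Some x)
        show ?thesis
        proof (cases "i = 0")
          case True
          then show ?thesis by (simp add: Some i e_Some)
        next
          case False
          have x: "x \<in> {0..<M}" using v Some by auto
          have "(x + w (i - 1)) mod M \<noteq> x"
          proof
            assume "(x + w (i - 1)) mod M = x"
            then have "(x + w (i - 1)) mod M = x mod M" using x by simp
            then have "M dvd w (i - 1) - 0" by (simp add: mod_eq_dvd_iff)
            then have "w (i - 1) = 0"
              using w_range[of "i - 1"] False i by (intro int_eqI_of_dvd[of M]) (auto simp: M_def)
            then show False using w_range[of "i - 1"] False i by simp
          qed
          then show ?thesis using M0 False by (simp add: Some i e_Some)
        qed
      qed
    qed
  next
    fix v w' c i c' i'
    assume vw: "v \<in> ?V" "w' \<in> ?V" and i: "i < 2 * h" "i' < 2 * h"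
      and e1: "e v (c, i) = e w' (c', i')"
      and e2: "e v (c, Suc i mod (2 * h)) = e w' (c', Suc i' mod (2 * h))"
    show "v = w'"
    proof (cases v)
      case None
      show ?thesis
      proof (cases w')
        case (Some y)
        then have "y \<in> {0..<M}" using vw by auto
        then show ?thesis using mixed[of y i' i c' c] i e1 e2 None Some by simp
      qed (use None in simp)
    next
      case v: (Some x)
      then have x: "x \<in> {0..<M}" using vw by auto
      show ?thesis
      proof (cases w')
        case None
        then show ?thesis using mixed[OF x i, of c c'] e1 e2 v by simp
      next
        case w': (Some y)
        then have y: "y \<in> {0..<M}" using vw by auto
        have zero_iff: "i = 0 \<longleftrightarrow> i' = 0" using e1 unfolding v w' e_Some by (auto split: if_splits)
        have last_iff: "Suc i = 2 * h \<longleftrightarrow> Suc i' = 2 * h"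
        proof -
          have "Suc i mod (2 * h) = 0 \<longleftrightarrow> Suc i' mod (2 * h) = 0"
            using e2 unfolding v w' e_Some by (auto split: if_splits)
          then show ?thesis using i by (auto simp: mod_Suc split: if_splits)
        qed
        have dvd1: "M dvd (x + w (i - 1)) - (y + w (i' - 1))" if "i \<noteq> 0"
          using e1 that zero_iff unfolding v w' e_Some by (simp add: mod_eq_dvd_iff)
        have dvd2: "M dvd (x + w i) - (y + w i')" if "Suc i \<noteq> 2 * h"
        proof -
          have "Suc i mod (2 * h) = Suc i" "Suc i' mod (2 * h) = Suc i'" using that last_iff i by simp_all
          then show ?thesis using e2 unfolding v w' e_Some by (simp add: mod_eq_dvd_iff)
        qed
        \<comment> \<open>An arc leaving or entering \<open>None\<close> sits at the first or last
          position, so its other end fixes the translate; an interior arc is located by its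
          difference.\<close>
        have "M dvd x - y"
        proof (cases "i = 0")
          case True
          then show ?thesis using dvd2 zero_iff h by simp
        next
          case i0: False
          show ?thesis
          proof (cases "Suc i = 2 * h")
            case True
            then have "i = i'" using last_iff by simp
            then show ?thesis using dvd1[OF i0] by simp
          next
            case False
            have "Suc (i - 1) = i" "Suc (i' - 1) = i'" using i0 zero_iff by simp_all
            then have "((x + w i) - (y + w i')) - ((x + w (i - 1)) - (y + w (i' - 1))) =
                D (i - 1) - D (i' - 1)"
              using w_Suc[of "i - 1"] w_Suc[of "i' - 1"] by simp
            then have "M dvd D (i - 1) - D (i' - 1)" using dvd_diff[OF dvd2[OF False] dvd1[OF i0]] by simp
            moreover have "i - 1 + 2 < 2 * h" "i' - 1 + 2 < 2 * h"
              using i0 False zero_iff last_iff i by simp_all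
            ultimately have "i - 1 = i' - 1" by (rule D_inj)
            then have "i = i'" using i0 zero_iff by simp
            then show ?thesis using dvd1[OF i0] by simp
          qed
        qed
        then show ?thesis using eq[OF x y] v w' by simp
      qed
    qed
  qed
  then obtain op where "near_cyclic (2 * h) ?V op" by blast
  then show ?thesis
    by (rule has_near_cyclicI) (subst card_insert_disjoint, auto simp: card_image M_def)
qed

section \<open>Near-factorizations from frames\<close>

text \<open>\<open>None\<close> plays infinity. The near-factor missing \<open>Some p\<close> joins
  \<open>M p\<close> outside the group of \<open>p\<close> to the filled group with infinity; the
  one missing infinity is the union over all groups. Arcs of \<open>M\<close> join different groups,
  so they never meet the arcs used for filling.\<close>

lemma near_cyclic_fill:
  assumes a: "a \<ge> 2" and fin: "finite P"
    and op0: "\<And>p. p \<in> P \<Longrightarrow> near_cyclic a (insert None (Some ` {q \<in> P. grp q = grp p})) (op0 (grp p))"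
    and M_reg: "\<And>p. p \<in> P \<Longrightarrow> regular_cyc a (M p) {q \<in> P. grp q \<noteq> grp p}"
    and M_grp: "\<And>p q. p \<in> P \<Longrightarrow> q \<in> P \<Longrightarrow> grp q \<noteq> grp p \<Longrightarrow> grp (M p q) \<noteq> grp q"
    and M_inj: "\<And>p p' q. \<lbrakk>p \<in> P; p' \<in> P; q \<in> P; grp q \<noteq> grp p; grp q \<noteq> grp p'; M p q = M p' q\<rbrakk>
      \<Longrightarrow> p = p'"
  shows "\<exists>op. near_cyclic a (insert None (Some ` P)) op"
proof -
  define G where "G \<gamma> = insert None (Some ` {q \<in> P. grp q = \<gamma>})" for \<gamma>
  have nc: "near_cyclic a (G (grp p)) (op0 (grp p))" if "p \<in> P" for p
    using op0[OF that] unfolding G_def .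
  have G_None: "None \<in> G \<gamma>" for \<gamma> unfolding G_def by simp
  have G_Some: "Some q \<in> G \<gamma> \<longleftrightarrow> q \<in> P \<and> grp q = \<gamma>" for q \<gamma> unfolding G_def by auto
  have G_sub: "G \<gamma> \<subseteq> insert None (Some ` P)" for \<gamma> unfolding G_def by auto
  \<comment> \<open>The value at \<open>None\<close>, \<open>None\<close> is a dummy, as a
    near-factor ignores its missing point.\<close>
  define op where "op v x = (case v of
      None \<Rightarrow> (case x of None \<Rightarrow> None | Some q \<Rightarrow> op0 (grp q) None x)
    | Some p \<Rightarrow> (case x of None \<Rightarrow> op0 (grp p) v None
        | Some q \<Rightarrow> if grp q = grp p then op0 (grp p) v x else Some (M p q)))" for v x
  have op_None_Some: "op None (Some q) = op0 (grp q) None (Some q)" for q by (simp add: op_def)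
  have op_Some: "op (Some p) x = op0 (grp p) (Some p) x" if "x \<in> G (grp p)" for p x
    using that by (cases x) (simp_all add: op_def G_Some)
  have op_frame: "op (Some p) (Some q) = Some (M p q)" if "grp q \<noteq> grp p" for p q
    using that by (simp add: op_def)
  have reg: "regular_cyc a (op v) (insert None (Some ` P) - {v})" if v: "v \<in> insert None (Some ` P)" for v
  proof (rule regular_cyc_local)
    fix x assume x: "x \<in> insert None (Some ` P) - {v}"
    show "\<exists>S'. x \<in> S' \<and> S' \<subseteq> insert None (Some ` P) - {v} \<and> regular_cyc a (op v) S'"
    proof (cases v)
      case None
      then obtain q where q: "x = Some q" "q \<in> P" using x by auto
      have "regular_cyc a (op0 (grp q) None) (G (grp q) - {None})"
        using nc[OF q(2)] G_None unfolding near_cyclic_def by simp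
      then have "regular_cyc a (op None) (G (grp q) - {None})"
      proof (rule regular_cyc_cong)
        fix y assume "y \<in> G (grp q) - {None}"
        then obtain r where "y = Some r" "grp r = grp q" unfolding G_def by auto
        then show "op None y = op0 (grp q) None y" by (simp add: op_None_Some)
      qed
      moreover have "x \<in> G (grp q) - {None}" using q by (simp add: G_Some)
      moreover have "G (grp q) - {None} \<subseteq> insert None (Some ` P) - {v}" unfolding None using G_sub by (rule Diff_mono) simp
      ultimately show ?thesis unfolding None by (intro exI[of _ "G (grp q) - {None}"] conjI)
    next
      case (Some p)
      then have p: "p \<in> P" using v by auto
      show ?thesis
      proof (cases "x \<in> G (grp p)")
        case True
        have "regular_cyc a (op0 (grp p) (Some p)) (G (grp p) - {Some p})"
          using nc[OF p] p unfolding near_cyclic_def by (simp add: G_Some)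
        then have "regular_cyc a (op (Some p)) (G (grp p) - {Some p})"
          by (rule regular_cyc_cong) (simp add: op_Some)
        moreover have "x \<in> G (grp p) - {Some p}" using True x Some by simp
        moreover have "G (grp p) - {Some p} \<subseteq> insert None (Some ` P) - {v}" unfolding Some using G_sub by (rule Diff_mono) simp
        ultimately show ?thesis unfolding Some by (intro exI[of _ "G (grp p) - {Some p}"] conjI)
      next
        case False
        then obtain q where q: "x = Some q" "q \<in> P" "grp q \<noteq> grp p"
          using x G_None by (cases x) (auto simp: G_Some)
        have "regular_cyc a (op (Some p)) (Some ` {q \<in> P. grp q \<noteq> grp p})"
          by (rule regular_cyc_conj[OF M_reg[OF p]]) (auto simp: op_frame bij_betw_def)
        moreover have "x \<in> Some ` {q \<in> P. grp q \<noteq> grp p}" using q by simp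
        moreover have "Some ` {q \<in> P. grp q \<noteq> grp p} \<subseteq> insert None (Some ` P) - {v}"
          using Some by auto
        ultimately show ?thesis unfolding Some by (intro exI[of _ "Some ` {q \<in> P. grp q \<noteq> grp p}"] conjI)
      qed
    qed
  qed
  have inj: "inj_on (\<lambda>v. op v x) (insert None (Some ` P) - {x})" if x: "x \<in> insert None (Some ` P)" for x
  proof (rule inj_onI)
    fix v w assume v: "v \<in> insert None (Some ` P) - {x}" and w: "w \<in> insert None (Some ` P) - {x}"
      and vw: "op v x = op w x"
    show "v = w"
    proof (cases x)
      case None
      obtain p where p: "v = Some p" "p \<in> P" using v None by auto
      obtain p' where p': "w = Some p'" "p' \<in> P" using w None by auto
      \<comment> \<open>The successor of infinity stays in the group of the missing point, so equal
        successors reveal equal groups.\<close>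
      have res: "op (Some p) None \<in> Some ` {q \<in> P. grp q = grp p}" if "p \<in> P" for p
        using near_cyclic_closed[OF nc[OF that] a, of "Some p" None] that op_Some[OF G_None, of p]
        by (auto simp: G_def)
      have grp_eq: "grp p = grp p'"
        using res[OF p(2)] res[OF p'(2)] vw unfolding p(1) p'(1) None by auto
      have inj0: "inj_on (\<lambda>v. op0 (grp p) v None) (G (grp p) - {None})"
        using nc[OF p(2)] G_None unfolding near_cyclic_def by simp
      show ?thesis
      proof (rule inj_onD[OF inj0])
        show "op0 (grp p) v None = op0 (grp p) w None"
          using vw op_Some[OF G_None, of p] op_Some[OF G_None, of p'] unfolding p(1) p'(1) None grp_eq by simp
      qed (use p p' grp_eq in \<open>simp_all add: G_Some\<close>)
    next
      case (Some q)
      then have q: "q \<in> P" using x by auto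
      have inside: "op v (Some q) = op0 (grp q) v (Some q) \<and> op v (Some q) \<in> G (grp q)"
        if "v \<in> G (grp q)" "v \<noteq> Some q" for v
      proof -
        have "op v (Some q) = op0 (grp q) v (Some q)"
          using that(1) q by (cases v) (simp_all add: op_None_Some op_Some G_Some)
        then show ?thesis
          using near_cyclic_closed[OF nc[OF q] a that(1) _ that(2)] q by (simp add: G_Some)
      qed
      have outside: "\<exists>p. v = Some p \<and> p \<in> P \<and> grp q \<noteq> grp p \<and> op v (Some q) = Some (M p q) \<and>
          op v (Some q) \<notin> G (grp q)"
        if v: "v \<in> insert None (Some ` P)" "v \<notin> G (grp q)" for v
      proof -
        obtain p where p: "v = Some p" "p \<in> P" "grp q \<noteq> grp p"
          using v G_None by (cases v) (auto simp: G_Some)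
        then show ?thesis using M_grp[OF p(2) q p(3)] by (simp add: op_frame G_Some)
      qed
      show ?thesis
      proof (cases "v \<in> G (grp q)")
        case vG: True
        have wG: "w \<in> G (grp q)"
        proof (rule ccontr)
          assume "w \<notin> G (grp q)"
          then have "op w (Some q) \<notin> G (grp q)" using outside[of w] w by blast
          then show False using inside[OF vG] vw v Some by simp
        qed
        have inj0: "inj_on (\<lambda>v. op0 (grp q) v (Some q)) (G (grp q) - {Some q})"
          using nc[OF q] q unfolding near_cyclic_def by (simp add: G_Some)
        show ?thesis
        proof (rule inj_onD[OF inj0])
          show "op0 (grp q) v (Some q) = op0 (grp q) w (Some q)"
            using inside[OF vG] inside[OF wG] vw v w Some by simp
        qed (use v w vG wG Some in simp_all)
      next
        case vG: False
        obtain p where p: "v = Some p" "p \<in> P" "grp q \<noteq> grp p" "op v (Some q) = Some (M p q)"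
          "op v (Some q) \<notin> G (grp q)"
          using outside[OF _ vG] v by blast
        have wG: "w \<notin> G (grp q)"
        proof
          assume "w \<in> G (grp q)"
          then show False using inside[of w] p(5) vw w Some by auto
        qed
        obtain p' where p': "w = Some p'" "p' \<in> P" "grp q \<noteq> grp p'" "op w (Some q) = Some (M p' q)"
          using outside[OF _ wG] w by blast
        have "M p q = M p' q" using p(4) p'(4) vw Some by simp
        then have "p = p'" by (rule M_inj[OF p(2) p'(2) q p(3) p'(3)])
        then show ?thesis using p(1) p'(1) by simp
      qed
    qed
  qed
  have "finite (insert None (Some ` P))" using fin by simp
  then show ?thesis
    unfolding near_cyclic_def by (intro exI[of _ op] conjI ballI reg inj)
qed

text \<open>Here \<open>mu i\<close> is a perfect matching of the points outside the group of \<open>i\<close>, oriented by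
  \<open>orient i\<close>; each of its edges is blown up to a complete bipartite graph.\<close>

lemma has_near_cyclic_frame:
  fixes R :: "'r set" and grp :: "'r \<Rightarrow> 'g" and mu :: "'r \<Rightarrow> 'r \<Rightarrow> 'r" and orient :: "'r \<Rightarrow> 'r \<Rightarrow> bool"
  assumes fin: "finite R" and h: "h > 0" and q: "q > 0"
    and mu: "\<And>i l. i \<in> R \<Longrightarrow> l \<in> R \<Longrightarrow> grp l \<noteq> grp i \<Longrightarrow>
      mu i l \<in> R \<and> grp (mu i l) \<noteq> grp i \<and> grp (mu i l) \<noteq> grp l \<and> mu i (mu i l) = l \<and>
      (orient i (mu i l) \<longleftrightarrow> \<not> orient i l)"
    and mu_inj: "\<And>i j l. \<lbrakk>i \<in> R; j \<in> R; l \<in> R; grp l \<noteq> grp i; grp l \<noteq> grp j; mu i l = mu j l\<rbrakk> \<Longrightarrow> i = j"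
    and fill: "\<And>i. i \<in> R \<Longrightarrow> has_near_cyclic (2 * h) (card {r \<in> R. grp r = grp i} * (h * q) + 1)"
  shows "has_near_cyclic (2 * h) (card R * (h * q) + 1)"
proof -
  define X where "X = int (h * q)"
  have X0: "X > 0" using h q by (simp add: X_def)
  define P where "P = R \<times> {0..<X}"
  \<comment> \<open>Going along a matching edge shifts by \<open>c\<close> and coming back by
    \<open>q - c\<close>. The total \<open>q\<close> has order \<open>h\<close> modulo
    \<open>h * q\<close>, so each 2-cycle lifts to cycles of length \<open>2 * h\<close>.\<close>
  define d where "d i c l = (if orient i l then c else int q - c)" for i c l
  define M where "M p = (\<lambda>(l, y). (mu (fst p) l, (y + d (fst p) (snd p) l) mod X))" for p
  have finP: "finite P" using fin by (simp add: P_def)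
  have order: "X dvd int q * t \<longleftrightarrow> int h dvd t" for t
    using q by (simp add: X_def mult.commute[of "int q"])
  have group: "{r \<in> P. grp (fst r) = \<gamma>} = {r \<in> R. grp r = \<gamma>} \<times> {0..<X}" for \<gamma>
    by (auto simp: P_def)
  have "\<exists>op0. \<forall>\<gamma>\<in>grp ` R. near_cyclic (2 * h) (insert None (Some ` {r \<in> P. grp (fst r) = \<gamma>})) (op0 \<gamma>)"
  proof (rule bchoice, rule ballI)
    fix \<gamma> assume "\<gamma> \<in> grp ` R"
    then obtain i where i: "i \<in> R" "\<gamma> = grp i" by blast
    have "finite {r \<in> P. grp (fst r) = \<gamma>}" using finP by simp
    moreover have "card {r \<in> P. grp (fst r) = \<gamma>} = card {r \<in> R. grp r = \<gamma>} * (h * q)"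
      unfolding group by (simp only: card_cartesian_product X_def card_atLeastLessThan_int diff_zero nat_int)
    ultimately have "card (insert None (Some ` {r \<in> P. grp (fst r) = \<gamma>})) = card {r \<in> R. grp r = \<gamma>} * (h * q) + 1"
      by (subst card_insert_disjoint) (auto simp: card_image)
    then show "\<exists>op. near_cyclic (2 * h) (insert None (Some ` {r \<in> P. grp (fst r) = \<gamma>})) op"
      using fill[OF i(1)] finP i(2) by (intro has_near_cyclicD) simp_all
  qed
  then obtain op0 where op0: "\<And>\<gamma>. \<gamma> \<in> grp ` R \<Longrightarrow>
      near_cyclic (2 * h) (insert None (Some ` {r \<in> P. grp (fst r) = \<gamma>})) (op0 \<gamma>)" by blast
  have "\<exists>op. near_cyclic (2 * h) (insert None (Some ` P)) op"
  proof (rule near_cyclic_fill[where grp = "\<lambda>r. grp (fst r)" and ?op0.0 = op0 and M = M])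
    show "2 * h \<ge> 2" "finite P" using h finP by simp_all
    show "near_cyclic (2 * h) (insert None (Some ` {r \<in> P. grp (fst r) = grp (fst p)})) (op0 (grp (fst p)))"
      if "p \<in> P" for p
      using that by (intro op0) (auto simp: P_def)
  next
    fix p assume "p \<in> P"
    then obtain i c where p: "p = (i, c)" "i \<in> R" "c \<in> {0..<X}" unfolding P_def by (rule SigmaE)
    let ?S = "{l \<in> R. grp l \<noteq> grp i}"
    define pos where "pos l = (if orient i l then 0 else 1 :: nat)" for l
    have reg2: "regular_cyc 2 (mu i) ?S"
      unfolding regular_cyc_def
    proof (intro ballI conjI allI)
      fix l assume "l \<in> ?S"
      then have l: "l \<in> R" "grp l \<noteq> grp i" by simp_all
      show "mu i l \<in> ?S" using mu[OF p(2) l] by simp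
      fix j
      have pow: "(mu i ^^ j) l = (if even j then l else mu i l)"
        by (induction j) (use mu[OF p(2) l] in auto)
      have "mu i l \<noteq> l" using mu[OF p(2) l] by auto
      then show "(mu i ^^ j) l = l \<longleftrightarrow> 2 dvd j" unfolding pow by simp
    qed
    \<comment> \<open>This is the lift of cycles of length 2, with \<open>c' = c - int q\<close> so
      that the net shift is \<open>q\<close>.\<close>
    have "regular_cyc (2 * h) (\<lambda>(l, y). (mu i l, (y + d i c l) mod X)) (?S \<times> {0..<X})"
    proof (rule regular_cyc_lift[where pos = pos and c = c and c' = "c - int q", OF reg2 _ _ X0])
      show "pos l < 2 \<and> pos (mu i l) = Suc (pos l) mod 2" if "l \<in> ?S" for l
        using mu[OF p(2), of l] that by (simp add: pos_def)
    qed (simp_all add: order d_def pos_def)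
    moreover have "?S \<times> {0..<X} = {r \<in> P. grp (fst r) \<noteq> grp (fst p)}" by (auto simp: P_def p(1))
    ultimately show "regular_cyc (2 * h) (M p) {r \<in> P. grp (fst r) \<noteq> grp (fst p)}"
      by (simp add: M_def p(1))
  next
    fix p r assume "p \<in> P" "r \<in> P" "grp (fst r) \<noteq> grp (fst p)"
    then show "grp (fst (M p r)) \<noteq> grp (fst r)"
      using mu[of "fst p" "fst r"] by (auto simp: M_def P_def split: prod.splits)
  next
    fix p p' r assume p: "p \<in> P" and p': "p' \<in> P" and r: "r \<in> P"
      and ne: "grp (fst r) \<noteq> grp (fst p)" "grp (fst r) \<noteq> grp (fst p')" and eq: "M p r = M p' r"
    obtain i c where ic: "p = (i, c)" "i \<in> R" "c \<in> {0..<X}" using p unfolding P_def by (rule SigmaE)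
    obtain i' c' where ic': "p' = (i', c')" "i' \<in> R" "c' \<in> {0..<X}" using p' unfolding P_def by (rule SigmaE)
    obtain l y where ly: "r = (l, y)" "l \<in> R" using r unfolding P_def by (rule SigmaE)
    have "mu i l = mu i' l" using eq by (simp add: M_def ic(1) ic'(1) ly(1))
    then have i: "i = i'" using ne by (intro mu_inj[OF ic(2) ic'(2) ly(2)]) (simp_all add: ic(1) ic'(1) ly(1))
    have "(y + d i c l) mod X = (y + d i c' l) mod X" using eq by (simp add: M_def ic(1) ic'(1) ly(1) i)
    then have "X dvd d i c l - d i c' l" by (simp add: mod_eq_dvd_iff)
    then have "X dvd c - c'" by (auto simp: d_def dvd_diff_commute split: if_splits)
    then have "c = c'" using ic(3) ic'(3) by (intro int_eqI_of_dvd[of X]) auto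
    then show "p = p'" using i ic(1) ic'(1) by simp
  qed
  then obtain op where "near_cyclic (2 * h) (insert None (Some ` P)) op" by blast
  moreover have "card P = card R * (h * q)"
    unfolding P_def by (simp only: card_cartesian_product X_def card_atLeastLessThan_int diff_zero nat_int)
  then have "card (insert None (Some ` P)) = card R * (h * q) + 1"
    using finP by (subst card_insert_disjoint) (auto simp: card_image)
  ultimately show ?thesis by (rule has_near_cyclicI)
qed

section \<open>Two concrete frames\<close>

text \<open>The groups are single residues modulo \<open>r\<close>, and the matching is the
  reflection about \<open>i\<close>. As \<open>r\<close> is odd, \<open>i\<close> is its only fixed
  point, and distinct centres never agree at a point.\<close>

lemma has_near_cyclic_odd_frame:
  assumes r: "odd r" and h: "h > 0" and q: "q > 0" and fill: "has_near_cyclic (2 * h) (h * q + 1)"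
  shows "has_near_cyclic (2 * h) (r * (h * q) + 1)"
proof -
  define R where "R = {0..<int r}"
  have r0: "int r > 0" using r by (cases r) auto
  have eqI: "i = j" if "int r dvd i - j" "i \<in> R" "j \<in> R" for i j
    using that(2,3) by (intro int_eqI_of_dvd[OF that(1)]) (auto simp: R_def)
  have odd_dvd: "int r dvd x" if "int r dvd 2 * x" for x
    using that r coprime_dvd_mult_right_iff[of "int r" 2 x] by simp
  define mu where "mu i l = (2 * i - l) mod int r" for i l
  \<comment> \<open>A point and its mirror image have opposite offsets from \<open>i\<close>;
    comparing the two residues picks one point of each pair.\<close>
  define orient where "orient i l \<longleftrightarrow> (l - i) mod int r < (i - l) mod int r" for i l
  have "has_near_cyclic (2 * h) (card R * (h * q) + 1)"
  proof (rule has_near_cyclic_frame[where grp = "\<lambda>i. i" and mu = mu and orient = orient, OF _ h q])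
    show "finite R" by (simp add: R_def)
  next
    fix i l assume il: "i \<in> R" "l \<in> R" "l \<noteq> i"
    have mu_R: "mu i l \<in> R" using r0 by (simp add: mu_def R_def)
    have mu_dvd: "int r dvd mu i l - (2 * i - l)" unfolding mu_def by (simp add: mod_eq_dvd_iff[symmetric])
    have "mu i l \<noteq> i"
    proof
      assume "mu i l = i"
      then have "int r dvd l - i" using mu_dvd by (simp add: algebra_simps)
      then show False using eqI il by blast
    qed
    moreover have "mu i l \<noteq> l"
    proof
      assume "mu i l = l"
      then have "int r dvd 2 * (l - i)" using mu_dvd by (simp add: algebra_simps)
      then show False using eqI odd_dvd il by blast
    qed
    moreover have "mu i (mu i l) = l"
    proof -
      have "mu i (mu i l) = (2 * i - (2 * i - l)) mod int r" unfolding mu_def by (rule mod_diff_right_eq)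
      then show ?thesis using il(2) by (simp add: R_def)
    qed
    moreover have "orient i (mu i l) \<longleftrightarrow> \<not> orient i l"
    proof -
      have "(mu i l - i) mod int r = (2 * i - l - i) mod int r" unfolding mu_def by (rule mod_diff_left_eq)
      moreover have "(i - mu i l) mod int r = (i - (2 * i - l)) mod int r" unfolding mu_def by (rule mod_diff_right_eq)
      moreover have "(l - i) mod int r \<noteq> (i - l) mod int r"
      proof
        assume "(l - i) mod int r = (i - l) mod int r"
        then have "int r dvd 2 * (l - i)" by (simp add: mod_eq_dvd_iff algebra_simps)
        then show False using eqI odd_dvd il by blast
      qed
      ultimately show ?thesis unfolding orient_def by (auto simp: algebra_simps)
    qed
    ultimately show "mu i l \<in> R \<and> mu i l \<noteq> i \<and> mu i l \<noteq> l \<and> mu i (mu i l) = l \<and>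
        (orient i (mu i l) \<longleftrightarrow> \<not> orient i l)" using mu_R by blast
  next
    fix i j l assume ij: "i \<in> R" "j \<in> R" "mu i l = mu j l"
    then have "int r dvd 2 * (i - j)" unfolding mu_def by (simp add: mod_eq_dvd_iff algebra_simps)
    then show "i = j" using eqI odd_dvd ij by blast
  next
    fix i assume "i \<in> R"
    then have "{j \<in> R. j = i} = {i}" by auto
    then show "has_near_cyclic (2 * h) (card {j \<in> R. j = i} * (h * q) + 1)" using fill by simp
  qed
  then show ?thesis by (simp add: R_def)
qed

text \<open>The pairs \<open>{1,2}\<close>, \<open>{3,6}\<close>, \<open>{5,7}\<close> have the differences \<open>\<plusminus>1\<close>, \<open>\<plusminus>3\<close>, \<open>\<plusminus>2\<close> modulo 8, that is,
  every residue outside the subgroup \<open>{0,4}\<close> exactly once.\<close>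

lemma has_near_cyclic_quadruple_frame:
  assumes h: "h > 0" and q: "q > 0" and fill: "has_near_cyclic (2 * h) (2 * (h * q) + 1)"
  shows "has_near_cyclic (2 * h) (8 * (h * q) + 1)"
proof -
  \<comment> \<open>The table swaps the members of each base pair; the entries at 0 and 4 are
    dummies, since these residues form the omitted group.\<close>
  define mate :: "nat \<Rightarrow> nat" where "mate x = [0, 2, 1, 6, 4, 7, 3, 5] ! x" for x
  define mu where "mu i l = (i + mate ((l + 8 - i) mod 8)) mod 8" for i l
  define orient where "orient i l \<longleftrightarrow> (l + 8 - i) mod 8 \<in> {1, 3, 5}" for i l :: nat
  let ?R = "set [0..<8]"
  have matching: "\<forall>i\<in>?R. \<forall>l\<in>?R. l mod 4 \<noteq> i mod 4 \<longrightarrow>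
      mu i l \<in> ?R \<and> mu i l mod 4 \<noteq> i mod 4 \<and> mu i l mod 4 \<noteq> l mod 4 \<and> mu i (mu i l) = l \<and>
      (orient i (mu i l) \<longleftrightarrow> \<not> orient i l)"
    unfolding mu_def mate_def orient_def by code_simp
  have inj: "\<forall>i\<in>?R. \<forall>j\<in>?R. \<forall>l\<in>?R. l mod 4 \<noteq> i mod 4 \<longrightarrow> l mod 4 \<noteq> j mod 4 \<longrightarrow> mu i l = mu j l \<longrightarrow> i = j"
    unfolding mu_def mate_def by code_simp
  have card: "\<forall>i\<in>?R. card (set (filter (\<lambda>j. j mod 4 = i mod 4) [0..<8])) = (2 :: nat)"
    by code_simp
  have "has_near_cyclic (2 * h) (card ?R * (h * q) + 1)"
  proof (rule has_near_cyclic_frame[where grp = "\<lambda>i. i mod 4" and mu = mu and orient = orient, OF _ h q])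
    show "finite ?R" by simp
    show "has_near_cyclic (2 * h) (card {j \<in> ?R. j mod 4 = i mod 4} * (h * q) + 1)" if "i \<in> ?R" for i
      using bspec[OF card that] fill by (simp only: set_filter)
  qed (rule matching[rule_format], assumption+, rule inj[rule_format], assumption+)
  then show ?thesis by simp
qed

section \<open>Every even cycle length, and the theorem\<close>

text \<open>Only the case \<open>4 dvd s\<close> recurses, to \<open>s div 4\<close>. Odd
  \<open>s\<close> is filled with one block, twice an odd number with two blocks. The two-block
  solution requires \<open>h \<ge> 2\<close>, so cycles of length 2 are treated apart.\<close>

lemma has_near_cyclic_even:
  assumes h: "h > 0"
  shows "has_near_cyclic (2 * h) (2 * h * s + 1)"
proof (induction s rule: less_induct)
  case (less s)
  consider "s = 0" | "h = 1" | "s > 0" "4 dvd s" | "odd s" | r where "s = 2 * r" "odd r" "h \<ge> 2"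
  proof -
    have "s = 0 \<or> h = 1 \<or> s > 0 \<and> 4 dvd s \<or> odd s \<or> (\<exists>r. s = 2 * r \<and> odd r \<and> h \<ge> 2)"
      using h by (cases "even s"; cases "even (s div 2)") (auto elim!: evenE)
    then show ?thesis using that by blast
  qed
  then show ?case
  proof cases
    case 1
    have "near_cyclic (2 * h) {0 :: nat} (\<lambda>_ x. x)" by (simp add: near_cyclic_def regular_cyc_def)
    from has_near_cyclicI[OF this, of 1] show ?thesis using 1 by simp
  next
    case 2
    then show ?thesis using has_near_cyclic_2[of s] by simp
  next
    case 3
    then obtain t where t: "s = 4 * t" "t > 0" by auto
    have "has_near_cyclic (2 * h) (2 * h * t + 1)" using less[of t] t by simp
    then have "has_near_cyclic (2 * h) (2 * (h * t) + 1)" by (simp add: mult.assoc)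
    from has_near_cyclic_quadruple_frame[OF h t(2) this] show ?thesis by (simp add: t(1) mult_ac)
  next
    case 4
    have "has_near_cyclic (2 * h) (h * 2 + 1)" using has_near_cyclic_one_block[OF h] by (simp add: mult.commute)
    from has_near_cyclic_odd_frame[OF 4 h _ this] show ?thesis by (simp add: mult_ac)
  next
    case (5 r)
    have "has_near_cyclic (2 * h) (h * 4 + 1)"
      using has_near_cyclic_two_blocks[OF 5(3)] by (simp add: mult.commute)
    from has_near_cyclic_odd_frame[OF 5(2) h _ this] show ?thesis by (simp add: 5(1) mult_ac)
  qed
qed

theorem theorem4p7:
  fixes p :: "nat \<Rightarrow> nat" and t i k u g :: nat
  assumes "\<And>j. j \<in> {1..t} \<Longrightarrow> prime (p j)"
    and "k = (\<Prod>j=1..t. p j)"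
    and "k \<ge> 6"
    and "even k"
    and "1 \<le> i" and "i \<le> t - 1"
    and "\<exists>j\<in>{1..i}. p j = 2"
    and "u > 0" and "g > 0"
    and "[u = 1] (mod (\<Prod>j=1..i. p j))"
    and "odd g"
    and "[g = (\<Prod>j=i+1..t. p j)] (mod (2 * (\<Prod>j=i+1..t. p j)))"
  shows "\<exists>\<F>. is_ARCS k (tensor_multigraph u g 2) (tensor_parts u g) \<F>"
proof -
  define a where "a = (\<Prod>j=1..i. p j)"
  define b where "b = (\<Prod>j=i+1..t. p j)"
  have it: "i < t" using assms(5,6) by simp
  have k: "k = a * b"
  proof -
    have "{1..t} = {1..i} \<union> {i+1..t}" using it by auto
    then show ?thesis
      unfolding assms(2) a_def b_def by (simp add: prod.union_disjoint)
  qed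
  have "even a"
    using assms(7) dvd_prodI[of "{1..i}" _ p] unfolding a_def by force
  have "a > 0" using k assms(3) by (cases a) auto
  obtain h where h: "a = 2 * h" "h > 0" using \<open>even a\<close> \<open>a > 0\<close> by (auto elim!: evenE)
  have "b dvd g"
    using assms(12) cong_dvd_iff[of g b b] cong_modulus_mult_nat[of g b b 2]
    unfolding b_def by (simp add: mult.commute)
  then obtain m where m: "g = b * m" by blast
  have m0: "m > 0" using m assms(9) by (cases m) auto
  have "odd b" using m assms(11) by simp
  \<comment> \<open>Because \<open>i < t\<close>, the second product contains the prime
    \<open>p t\<close>; with oddness this gives \<open>b \<ge> 3\<close>, as the lift
    requires.\<close>
  moreover have "b \<noteq> 1"
  proof -
    have "p t dvd b" unfolding b_def using it by (intro dvd_prodI) auto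
    moreover have "prime (p t)" using assms(1)[of t] it by simp
    ultimately show ?thesis by (metis nat_dvd_1_iff_1 not_prime_1)
  qed
  ultimately have b: "odd b" "b \<ge> 3" by (auto elim!: oddE)
  have "a dvd u - 1"
    using assms(8,10) cong_altdef_nat[of 1 u a] unfolding a_def by (simp add: cong_sym_eq)
  then obtain s where "u - 1 = a * s" by blast
  then have u: "u = 2 * h * s + 1" using assms(8) h(1) by simp
  obtain op where "near_cyclic a {..<u} op"
    using has_near_cyclic_even[OF h(2), of s] unfolding has_near_cyclic_def h(1) u by blast
  then show ?thesis
    unfolding k using \<open>even a\<close> \<open>a > 0\<close> m b m0 by (rule ARCS_of_near_cyclic)
qed

end
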